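(* Let $f(z,w,t)=1+z+w+t$, and let $(x,y,u)\in\mathcal{A}_f\setminus\mathcal{C}$. The second order derivatives of the Ronkin function $N_f$ at $(x,y,u)$ can be expressed in terms of complete elliptic integrals of the first and third kind as \begin{align*} \frac{\partial^2 N_f}{\partial x^2} &= \frac{2ge^{2x}}{\pi^2}K(k), \\ \frac{\partial^2 N_f}{\partial x\,\partial y} &= \frac{-g}{2\pi^2}\left( Q_1K(k) + Q_2\Pi(\alpha_1^2,k) +Q_3\Pi(\alpha_2^2,k)\right), \end{align*} where $k^2,\alpha_1^2,\alpha_2^2,g^2,Q_1,Q_2,Q_3$ are rational functions of $e^x,e^y,e^u$ depending on which chamber $(x,y,u)$ lies in. With $$\xi:=(1+e^x+e^y-e^u)(1+e^x-e^y+e^u)(1-e^x+e^y+e^u)(-1+e^x+e^y+e^u),$$ they are as follows. In the chambers $(+,+,+)$ and $(+,-,-)$: \begin{align*} g&=\frac{1}{2\sqrt{e^{x+y+u}}},\quad k^2=\frac{\xi}{16e^{x+y+u}},\\ Q_1&=2\,\frac{e^y(e^{2x}+e^{2y}+e^{2u}-1-2e^{y+u})}{e^y-e^u},\quad Q_2=(1-e^x+e^y-e^u)(1-e^x-e^y+e^u),\\ Q_3&=\frac{(e^u+e^y)(1-e^x+e^y-e^u)(1+e^x)(1-e^x-e^y+e^u)}{(e^u-e^y)(e^x-1)},\\ \alpha_1^2&=\frac{(1-e^x+e^y+e^u)(-1+e^x+e^y+e^u)}{4e^{y+u}},\quad \alpha_2^2=\alpha_1^2\frac{(e^y-e^u)^2}{(1-e^x)^2}.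 \end{align*} In the chambers $(-,+,+)$ and $(-,-,-)$: \begin{align*} g&=\frac{2}{\sqrt{\xi}},\quad k^2=\frac{16e^{x+y+u}}{\xi},\\ Q_1&=2\,\frac{e^y(e^{2x}+e^{2y}+e^{2u}-1-2e^{y+u})}{e^y-e^u},\quad Q_2=(1-e^x+e^y-e^u)(1-e^x-e^y+e^u),\\ Q_3&=\frac{(e^u+e^y)(1-e^x+e^y-e^u)(1+e^x)(1-e^x-e^y+e^u)}{(e^u-e^y)(e^x-1)},\\ \alpha_1^2&=\frac{4e^x}{(1+e^x+e^y-e^u)(1+e^x-e^y+e^u)},\quad \alpha_2^2=\alpha_1^2\frac{(e^y-e^u)^2}{(1-e^x)^2}. \end{align*} In the chambers $(-,-,+)$ and $(-,+,-)$: \begin{align*} g&=\frac{1}{2\sqrt{e^{x+y+u}}},\quad k^2=\frac{\xi}{16e^{x+y+u}},\\ Q_1&=2\,\frac{e^x(e^{2x}+e^{2y}-e^{2u}+1-2e^{x})}{e^x-1},\quad Q_2=-(1-e^x+e^y-e^u)(1-e^x-e^y+e^u),\\ Q_3&=-\frac{(e^u+e^y)(1-e^x+e^y-e^u)(1+e^x)(1-e^x-e^y+e^u)}{(e^u-e^y)(e^x-1)},\\ \alpha_1^2&=\frac{(1+e^x-e^y+e^u)(1+e^x+e^y-e^u)}{4e^{x}},\quad \alpha_2^2=\alpha_1^2\frac{(e^x-1)^2}{(e^y-e^u)^2}. \end{align*} In the chambers $(+,-,+)$ and $(+,+,-)$: \begin{align*} g&=\frac{2}{\sqrt{\xi}},\quad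 k^2=\frac{16e^{x+y+u}}{\xi},\\ Q_1&=-2\,\frac{e^x(e^{2x}+e^{2y}-e^{2u}+1-2e^{x})}{1-e^x},\quad Q_2=-(1-e^x+e^y-e^u)(1-e^x-e^y+e^u),\\ Q_3&=-\frac{(e^u+e^y)(1-e^x+e^y-e^u)(1+e^x)(1-e^x-e^y+e^u)}{(e^u-e^y)(e^x-1)},\\ \alpha_1^2&=\frac{4e^{y+u}}{(1-e^x+e^y+e^u)(-1+e^x+e^y+e^u)},\quad \alpha_2^2=\alpha_1^2\frac{(1-e^x)^2}{(e^y-e^u)^2}. \end{align*}
   Context: Write $\mathrm{Log}:(\mathbb{C}^* )^3\to\mathbb{R}^3$, $\mathrm{Log}(z,w,t)=(\log|z|,\log|w|,\log|t|)$. The amoeba of $f$ is $\mathcal{A}_f=\mathrm{Log}(f^{-1}(0))$, where $f^{-1}(0)\subset(\mathbb{C}^* )^3$. The Ronkin function is $$N_f(x,y,u)=\left(\frac{1}{2\pi i}\right)^3\int_{\mathrm{Log}^{-1}(x,y,u)}\log|f(z,w,t)|\,\frac{dz\,dw\,dt}{zwt},$$ i.e. the mean of $\log|f|$ over the torus $|z|=e^x,|w|=e^y,|t|=e^u$. The contour $\mathcal{C}$ is the set of critical values of $\mathrm{Log}$ restricted to $f^{-1}(0)$. For $f=1+z+w+t$ it is the set of $(x,y,u)\in\mathbb{R}^3$ satisfying at least one of $1+e^x=e^y+e^u$, $1+e^y=e^x+e^u$, $1+e^u=e^x+e^y$, $e^x=1+e^y+e^u$, $e^y=1+e^x+e^u$,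 $e^u=1+e^x+e^y$, $1=e^x+e^y+e^u$. Chambers: a point $(x,y,u)\in\mathcal{A}_f\setminus\mathcal{C}$ belongs to the chamber $(\epsilon_1,\epsilon_2,\epsilon_3)\in\{+,-\}^3$, where $\epsilon_1,\epsilon_2,\epsilon_3$ are the signs of $1+e^x-e^y-e^u$, $1+e^y-e^x-e^u$, $1+e^u-e^x-e^y$ respectively. Complete elliptic integrals (with $k\geq 0$ the nonnegative root of $k^2$): $$K(k)=\int_0^{\pi/2}\frac{d\theta}{\sqrt{1-k^2\sin^2\theta}},\qquad \Pi(\alpha^2,k)=\int_0^{\pi/2}\frac{d\theta}{(1-\alpha^2\sin^2\theta)\sqrt{1-k^2\sin^2\theta}}.$$ At points of a chamber where one of the printed denominators $e^x-1$ or $e^y-e^u$ vanishes, the apparent singularity of the right-hand side of the mixed derivative formula is removable, and the right-hand side is understood as its continuous extension. *)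

theory Defs
  imports "HOL-Analysis.Analysis"
begin

section \<open>Amoeba, contour and Ronkin function in three variables\<close>

definition torus_points :: "(complex \<times> complex \<times> complex) set" where
  "torus_points = {(z, w, t). z \<noteq> 0 \<and> w \<noteq> 0 \<and> t \<noteq> 0}"

definition Log3 :: "complex \<times> complex \<times> complex \<Rightarrow> real \<times> real \<times> real" where
  "Log3 = (\<lambda>(z, w, t). (ln (cmod z), ln (cmod w), ln (cmod t)))"

definition zero_locus ::
  "(complex \<times> complex \<times> complex \<Rightarrow> complex) \<Rightarrow> (complex \<times> complex \<times> complex) set" where
  "zero_locus f = {p \<in> torus_points. f p = 0}"

definition amoeba ::
  "(complex \<times> complex \<times> complex \<Rightarrow> complex) \<Rightarrow> (real \<times> real \<times> real) set" where
  "amoeba f = Log3 ` zero_locus f"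

text \<open>
  The zero locus is assumed smooth (the differential of \<open>f\<close> vanishes nowhere on it), so that the
  kernel of the differential at \<open>p\<close> is the tangent space.  A point is critical for the restricted
  map if the differential of \<open>Log3\<close>, restricted to the tangent space, is not onto.
\<close>

definition contour ::
  "(complex \<times> complex \<times> complex \<Rightarrow> complex) \<Rightarrow> (real \<times> real \<times> real) set" where
  "contour f = Log3 ` {p \<in> zero_locus f.
     frechet_derivative Log3 (at p) ` {v. frechet_derivative f (at p) v = 0} \<noteq> UNIV}"

text \<open>
  Parametrising the torus by \<open>z = exp (x + \<i> \<theta>)\<close> etc. gives \<open>dz / z = \<i> d\<theta>\<close>.  The integrand is
  singular where \<open>f\<close> vanishes, hence the Lebesgue integral; the value \<open>ln 0 = 0\<close> on that null
  set does not matter.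
\<close>

definition ronkin ::
  "(complex \<times> complex \<times> complex \<Rightarrow> complex) \<Rightarrow> real \<times> real \<times> real \<Rightarrow> real" where
  "ronkin f = (\<lambda>(x, y, u). (1 / (2 * pi)) ^ 3 *
     (LINT (\<theta>, \<phi>, \<psi>) : {0..2 * pi} \<times> {0..2 * pi} \<times> {0..2 * pi} | lborel.
        ln (cmod (f (of_real (exp x) * cis \<theta>, of_real (exp y) * cis \<phi>, of_real (exp u) * cis \<psi>)))))"

definition lin_poly :: "complex \<times> complex \<times> complex \<Rightarrow> complex" where
  "lin_poly = (\<lambda>(z, w, t). 1 + z + w + t)"


section \<open>Second order partial derivatives\<close>

text \<open>
  Both predicates include the existence of the derivatives: the inner one along a neighbourhood
  on the relevant line, and the outer one at the point.
\<close>

definition has_partial_xx ::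
  "(real \<times> real \<times> real \<Rightarrow> real) \<Rightarrow> real \<Rightarrow> real \<times> real \<times> real \<Rightarrow> bool" where
  "has_partial_xx N d = (\<lambda>(x, y, u).
     (\<forall>\<^sub>F s in nhds x. (\<lambda>r. N (r, y, u)) differentiable (at s)) \<and>
     ((\<lambda>s. deriv (\<lambda>r. N (r, y, u)) s) has_real_derivative d) (at x))"

definition has_partial_xy ::
  "(real \<times> real \<times> real \<Rightarrow> real) \<Rightarrow> real \<Rightarrow> real \<times> real \<times> real \<Rightarrow> bool" where
  "has_partial_xy N d = (\<lambda>(x, y, u).
     (\<forall>\<^sub>F s in nhds x. (\<lambda>r. N (s, r, u)) differentiable (at y)) \<and>
     ((\<lambda>s. deriv (\<lambda>r. N (s, r, u)) y) has_real_derivative d) (at x))"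


section \<open>Complete elliptic integrals\<close>

definition ellK :: "real \<Rightarrow> real" where
  "ellK k = integral {0..pi / 2} (\<lambda>\<theta>. 1 / sqrt (1 - k\<^sup>2 * (sin \<theta>)\<^sup>2))"

text \<open>The first argument is the characteristic \<open>\<alpha>\<^sup>2\<close> itself, not \<open>\<alpha>\<close>; the second is the modulus.\<close>

definition ellPi :: "real \<Rightarrow> real \<Rightarrow> real" where
  "ellPi \<alpha>2 k =
     integral {0..pi / 2} (\<lambda>\<theta>. 1 / ((1 - \<alpha>2 * (sin \<theta>)\<^sup>2) * sqrt (1 - k\<^sup>2 * (sin \<theta>)\<^sup>2)))"


section \<open>Chambers and the coefficients attached to them\<close>

definition chamber :: "real \<times> real \<times> real \<Rightarrow> real \<times> real \<times> real" where
  "chamber = (\<lambda>(x, y, u).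
     (sgn (1 + exp x - exp y - exp u),
      sgn (1 + exp y - exp x - exp u),
      sgn (1 + exp u - exp x - exp y)))"

record coeffs =
  cf_g :: real
  cf_k2 :: real
  cf_Q1 :: real
  cf_Q2 :: real
  cf_Q3 :: real
  cf_\<alpha>1sq :: real
  cf_\<alpha>2sq :: real

text \<open>In the following, \<open>a, b, c\<close> stand for \<open>exp x, exp y, exp u\<close>.\<close>

definition xi :: "real \<Rightarrow> real \<Rightarrow> real \<Rightarrow> real" where
  "xi a b c = (1 + a + b - c) * (1 + a - b + c) * (1 - a + b + c) * (-1 + a + b + c)"

definition coeffs_A :: "real \<Rightarrow> real \<Rightarrow> real \<Rightarrow> coeffs" where
  "coeffs_A a b c =
    (let \<alpha>1sq = (1 - a + b + c) * (-1 + a + b + c) / (4 * (b * c)) in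
     \<lparr> cf_g = 1 / (2 * sqrt (a * b * c)),
       cf_k2 = xi a b c / (16 * (a * b * c)),
       cf_Q1 = 2 * (b * (a\<^sup>2 + b\<^sup>2 + c\<^sup>2 - 1 - 2 * (b * c)) / (b - c)),
       cf_Q2 = (1 - a + b - c) * (1 - a - b + c),
       cf_Q3 = (c + b) * (1 - a + b - c) * (1 + a) * (1 - a - b + c) / ((c - b) * (a - 1)),
       cf_\<alpha>1sq = \<alpha>1sq,
       cf_\<alpha>2sq = \<alpha>1sq * ((b - c)\<^sup>2 / (1 - a)\<^sup>2) \<rparr>)"

definition coeffs_B :: "real \<Rightarrow> real \<Rightarrow> real \<Rightarrow> coeffs" where
  "coeffs_B a b c =
    (let \<alpha>1sq = 4 * a / ((1 + a + b - c) * (1 + a - b + c)) in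
     \<lparr> cf_g = 2 / sqrt (xi a b c),
       cf_k2 = 16 * (a * b * c) / xi a b c,
       cf_Q1 = 2 * (b * (a\<^sup>2 + b\<^sup>2 + c\<^sup>2 - 1 - 2 * (b * c)) / (b - c)),
       cf_Q2 = (1 - a + b - c) * (1 - a - b + c),
       cf_Q3 = (c + b) * (1 - a + b - c) * (1 + a) * (1 - a - b + c) / ((c - b) * (a - 1)),
       cf_\<alpha>1sq = \<alpha>1sq,
       cf_\<alpha>2sq = \<alpha>1sq * ((b - c)\<^sup>2 / (1 - a)\<^sup>2) \<rparr>)"

definition coeffs_C :: "real \<Rightarrow> real \<Rightarrow> real \<Rightarrow> coeffs" where
  "coeffs_C a b c =
    (let \<alpha>1sq = (1 + a - b + c) * (1 + a + b - c) / (4 * a) in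
     \<lparr> cf_g = 1 / (2 * sqrt (a * b * c)),
       cf_k2 = xi a b c / (16 * (a * b * c)),
       cf_Q1 = 2 * (a * (a\<^sup>2 + b\<^sup>2 - c\<^sup>2 + 1 - 2 * a) / (a - 1)),
       cf_Q2 = - ((1 - a + b - c) * (1 - a - b + c)),
       cf_Q3 = - ((c + b) * (1 - a + b - c) * (1 + a) * (1 - a - b + c) / ((c - b) * (a - 1))),
       cf_\<alpha>1sq = \<alpha>1sq,
       cf_\<alpha>2sq = \<alpha>1sq * ((a - 1)\<^sup>2 / (b - c)\<^sup>2) \<rparr>)"

definition coeffs_D :: "real \<Rightarrow> real \<Rightarrow> real \<Rightarrow> coeffs" where
  "coeffs_D a b c =
    (let \<alpha>1sq = 4 * (b * c) / ((1 - a + b + c) * (-1 + a + b + c)) in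
     \<lparr> cf_g = 2 / sqrt (xi a b c),
       cf_k2 = 16 * (a * b * c) / xi a b c,
       cf_Q1 = - 2 * (a * (a\<^sup>2 + b\<^sup>2 - c\<^sup>2 + 1 - 2 * a) / (1 - a)),
       cf_Q2 = - ((1 - a + b - c) * (1 - a - b + c)),
       cf_Q3 = - ((c + b) * (1 - a + b - c) * (1 + a) * (1 - a - b + c) / ((c - b) * (a - 1))),
       cf_\<alpha>1sq = \<alpha>1sq,
       cf_\<alpha>2sq = \<alpha>1sq * ((1 - a)\<^sup>2 / (b - c)\<^sup>2) \<rparr>)"

text \<open>
  Off the contour all three signs are nonzero, so the last branch is reached exactly in the two
  remaining chambers \<open>(+,-,+)\<close> and \<open>(+,+,-)\<close>.
\<close>

definition coeffs_at :: "real \<times> real \<times> real \<Rightarrow> coeffs" where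
  "coeffs_at p = (case p of (x, y, u) \<Rightarrow>
     if chamber p \<in> {(1, 1, 1), (1, -1, -1)} then coeffs_A (exp x) (exp y) (exp u)
     else if chamber p \<in> {(-1, 1, 1), (-1, -1, -1)} then coeffs_B (exp x) (exp y) (exp u)
     else if chamber p \<in> {(-1, -1, 1), (-1, 1, -1)} then coeffs_C (exp x) (exp y) (exp u)
     else coeffs_D (exp x) (exp y) (exp u))"

definition modulus_at :: "real \<times> real \<times> real \<Rightarrow> real" where
  "modulus_at p = sqrt (cf_k2 (coeffs_at p))"

definition rhs_xx :: "real \<times> real \<times> real \<Rightarrow> real" where
  "rhs_xx p = 2 * cf_g (coeffs_at p) * exp (2 * fst p) / pi\<^sup>2 * ellK (modulus_at p)"

definition rhs_xy :: "real \<times> real \<times> real \<Rightarrow> real" where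
  "rhs_xy p = (let C = coeffs_at p; k = modulus_at p in
     - cf_g C / (2 * pi\<^sup>2) *
       (cf_Q1 C * ellK k + cf_Q2 C * ellPi (cf_\<alpha>1sq C) k + cf_Q3 C * ellPi (cf_\<alpha>2sq C) k))"

definition nondegenerate :: "(real \<times> real \<times> real) set" where
  "nondegenerate = {(x, y, u). exp x - 1 \<noteq> 0 \<and> exp y - exp u \<noteq> 0}"

text \<open>
  \<open>extends_to R S p v\<close>: the value at \<open>p\<close> of the continuous extension of \<open>R\<close> from the set \<open>S\<close>
  exists and is \<open>v\<close>.  The complement of the set \<open>nondegenerate\<close> has empty interior, so the limit
  in the second case is never taken along the trivial filter when \<open>S = nondegenerate\<close>.
\<close>

definition extends_to ::
  "(real \<times> real \<times> real \<Rightarrow> real) \<Rightarrow> (real \<times> real \<times> real) set \<Rightarrow>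
     real \<times> real \<times> real \<Rightarrow> real \<Rightarrow> bool" where
  "extends_to R S p v \<longleftrightarrow> (if p \<in> S then R p = v else (R \<longlongrightarrow> v) (at p within S))"

end

theory Submission
  imports Defs "HOL-Complex_Analysis.Cauchy_Integral_Formula"
begin

text \<open>
  Put \<open>a = exp x\<close>, \<open>b = exp y\<close>, \<open>c = exp u\<close>.  By Jensen's formula in one angle, the Ronkin function is the
  mean of \<open>ln (max \<bar>1 + a e\<^sup>i\<^sup>\<theta> + c e\<^sup>i\<^sup>\<psi>\<bar> b)\<close>, so its \<open>y\<close>-derivative is the probability that
  \<open>\<bar>1 + a e\<^sup>i\<^sup>\<theta> + c e\<^sup>i\<^sup>\<psi>\<bar> < b\<close>, and likewise for \<open>x\<close>.  For fixed \<open>\<theta>\<close>, with \<open>R = \<bar>1 + a e\<^sup>i\<^sup>\<theta>\<bar>\<^sup>2\<close>, this is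
  \<open>1 / \<pi>\<close> times the angle opposite \<open>b\<close> in the triangle with sides \<open>b\<close>, \<open>c\<close>, \<open>sqrt R\<close>.  Differentiating the
  angle and taking \<open>R\<close> as the variable leaves integrals of rational functions of \<open>R\<close> over the square root of
  the quartic with roots \<open>(1 \<plusminus> a)\<^sup>2\<close>, \<open>(b \<plusminus> c)\<^sup>2\<close>, taken between its two middle roots.  The chambers record
  the order of the four roots, and Legendre's substitution yields the complete integrals.  The integral
  itself depends continuously on the point, also where \<open>a = 1\<close> or \<open>b = c\<close>.
\<close>

section \<open>Jensen's formula on a circle\<close>

text \<open>Over a half turn of the angle, \<open>R\<close> sweeps the interval from (1 - a)^2 to (1
  + a)^2, while the triangle exists for \<open>R\<close> between (b - c)^2 and (b + c)^2. The
  integral lives on the intersection of the two intervals, hence the middle roots as limits. On the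
  amoeba off its contour the four ends are distinct and the intersection is a proper interval.
  Whether the intervals are interlaced or nested gives the two forms of \<open>cf_g\<close> and
  \<open>cf_k2\<close>; which interval has the smallest root gives the two forms of
  \<open>cf_Q1\<close>, \<open>cf_Q2\<close>, \<open>cf_Q3\<close>. In the pure derivative only the
  side opposite the angle moves, the weight is constant in \<open>R\<close>, and the first kind
  suffices. In the mixed derivative \<open>R\<close> itself moves, which brings in a factor 1 / R
  and with it the third kind. The points with a = 1 or b = c are those whose smallest root is 0. The
  integral starts at the second root, which stays positive, and so is regular there; only its
  splitting into \<open>ellK\<close> and \<open>ellPi\<close> divides by the smallest root. This is
  the source of the apparent singularity.\<close>

lemma has_integral_ln_norm_one_plus_cis:
  assumes "cmod p < 1"
  shows "((\<lambda>t. ln (cmod (1 + p * cis t))) has_integral 0) {0..2 * pi}"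
proof -
  let ?g = "\<lambda>z. Ln (1 + p * z)"
  have pos: "Re (1 + p * z) > 0" if "cmod z \<le> 1" for z
  proof -
    have "cmod (p * z) < 1"
      using assms that by (metis mult_left_le norm_ge_zero norm_mult order.strict_trans1)
    then show ?thesis
      using abs_Re_le_cmod[of "p * z"] by auto
  qed
  \<comment> \<open>Mean value property: Cauchy's formula at the centre gives the value Ln 1 =
    0.\<close>
  have "?g holomorphic_on cball 0 1"
    using pos by (intro holomorphic_intros) (force simp: complex_nonpos_Reals_iff)
  then have "((\<lambda>z. ?g z / (z - 0)) has_contour_integral 2 * of_real pi * \<i> * ?g 0) (circlepath 0 1)"
    by (rule Cauchy_integral_circlepath_simple) simp
  then have "((\<lambda>z. ?g z / z) has_contour_integral 0) (circlepath 0 1)"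
    by simp
  note int = this[unfolded has_contour_integral]
  have cp: "circlepath 0 1 t = cis (2 * pi * t)" for t
    by (simp add: circlepath cis_conv_exp mult_ac)
  have vd: "vector_derivative (circlepath 0 1) (at t) = 2 * pi * \<i> * cis (2 * pi * t)" for t
    by (simp add: vector_derivative_circlepath cis_conv_exp mult_ac)
  from int have "((\<lambda>t. ?g (cis (2 * pi * t)) / cis (2 * pi * t) * (2 * pi * \<i> * cis (2 * pi * t)))
      has_integral 0) {0..1}"
    by (rule has_integral_eq[rotated]) (simp add: vd cp)
  then have "((\<lambda>t. 2 * pi * \<i> * ?g (cis (2 * pi * t))) has_integral 0) {0..1}"
    by (simp add: mult_ac)
  \<comment> \<open>Im (2 pi i w) = 2 pi Re w, and the real part of \<open>Ln\<close> is the
    logarithm of the modulus.\<close>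
  then have "((\<lambda>t. Im (2 * pi * \<i> * ?g (cis (2 * pi * t)))) has_integral Im 0) {0..1}"
    by (rule has_integral_linear[OF _ bounded_linear_Im, unfolded o_def])
  then have "((\<lambda>t. Re (?g (cis (2 * pi * t))) * (2 * pi)) has_integral 0 * (2*pi)) {0..1}"
    by (simp add: mult_ac)
  from has_integral_mult_left[OF this, of "1 / (2 * pi)"]
  have "((\<lambda>t. Re (?g (cis (2 * pi * t)))) has_integral 0) {0..1}"
    by simp
  then have 1: "((\<lambda>t. Re (?g (cis t))) has_integral 0) ((\<lambda>x. (2*pi) * x) ` {0..1})"
    using has_integral_stretch_real[of "\<lambda>t. Re (?g (cis (2 * pi * t)))" 0 0 1 "1/(2*pi)"]
    by (simp add: image_def mult.commute)
  have "((\<lambda>x. (2*pi) * x) ` {0..1}) = {0..2*pi}"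
    using image_mult_atLeastAtMost[of "2*pi" 0 1] by simp
  then have "((\<lambda>t. Re (?g (cis t))) has_integral 0) {0..2*pi}" using 1 by simp
  moreover have "1 + p * cis t \<noteq> 0" for t using pos[of "cis t"] by force
  ultimately show ?thesis by simp
qed

text \<open>Pulling out the larger of \<open>cmod A\<close> and \<open>b\<close> leaves a factor 1 +
  p e^(it) with \<open>cmod p\<close> below 1, whose logarithm has mean 0.\<close>

lemma jensen_circle:
  assumes "b > 0" "cmod A \<noteq> b"
  shows "((\<lambda>t. ln (cmod (A + of_real b * cis t))) has_integral (2 * pi * ln (max (cmod A) b))) {0..2 * pi}"
    and "continuous_on UNIV (\<lambda>t. ln (cmod (A + of_real b * cis t)))"
proof -
  have ne: "A + of_real b * cis t \<noteq> 0" for t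
  proof
    assume "A + of_real b * cis t = 0"
    then have "cmod A = cmod (of_real b * cis t)" by (metis add_eq_0_iff norm_minus_cancel)
    then show False using assms by (simp add: norm_mult)
  qed
  then show "continuous_on UNIV (\<lambda>t. ln (cmod (A + of_real b * cis t)))"
    by (intro continuous_intros) auto
  have "\<exists>p. cmod p < 1 \<and> (\<forall>t. cmod (A + of_real b * cis t) = max (cmod A) b * cmod (1 + p * cis t))"
  proof (cases "cmod A > b")
    case True
    then have "cmod (of_real b / A) < 1" "A \<noteq> 0"
      using assms by (auto simp: norm_divide divide_simps)
    moreover have "cmod (A + of_real b * cis t) = cmod A * cmod (1 + of_real b / A * cis t)" for t
      using \<open>A \<noteq> 0\<close> by (simp flip: norm_mult add: algebra_simps)
    ultimately show ?thesis using True by (auto simp: max_def)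
  next
    case False
    then have "cmod (cnj A / of_real b) < 1"
      using assms by (auto simp: norm_divide divide_simps)
    \<comment> \<open>Conjugating and multiplying by \<open>cis t\<close> keeps the modulus and
      exchanges the roles of \<open>A\<close> and \<open>b\<close>; hence the witness with
      \<open>cnj A\<close>.\<close>
    moreover have "cmod (A + of_real b * cis t) = b * cmod (1 + cnj A / of_real b * cis t)" for t
    proof -
      have "cmod (A + of_real b * cis t) = cmod (cnj (A + of_real b * cis t) * cis t)"
        unfolding norm_mult complex_mod_cnj by simp
      also have "cnj (A + of_real b * cis t) * cis t = of_real b * (1 + cnj A / of_real b * cis t)"
        using assms by (simp add: algebra_simps cis_cnj cis_mult)
      finally show ?thesis using assms by (simp add: norm_mult)
    qed
    ultimately show ?thesis using False by (auto simp: max_def)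
  qed
  then obtain p where p: "cmod p < 1"
    "\<And>t. cmod (A + of_real b * cis t) = max (cmod A) b * cmod (1 + p * cis t)" by blast
  have m: "max (cmod A) b > 0" using assms by auto
  have "ln (cmod (A + of_real b * cis t)) = ln (max (cmod A) b) + ln (cmod (1 + p * cis t))" for t
    using ne[of t] p(2)[of t] m by (auto simp: ln_mult)
  moreover have "((\<lambda>t. ln (max (cmod A) b) + ln (cmod (1 + p * cis t))) has_integral
      (2 * pi) *\<^sub>R ln (max (cmod A) b) + 0) {0..2 * pi}"
    using has_integral_const_real[of "ln (max (cmod A) b)" 0 "2*pi"]
    by (intro has_integral_add has_integral_ln_norm_one_plus_cis p) (auto simp: measure_def)
  ultimately show "((\<lambda>t. ln (cmod (A + of_real b * cis t))) has_integral (2 * pi * ln (max (cmod A) b))) {0..2 * pi}"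
    by simp
qed

lemma countable_cos_eq: "countable {t::real. cos t = v}"
proof (cases "\<exists>s::real. cos s = v")
  case True
  then obtain s where s: "cos s = v" by auto
  have "{t. cos t = v} \<subseteq> (\<Union>n\<in>\<int>. {s + 2 * n * pi, - s + 2 * n * pi})"
    using cos_eq[of _ s] s by auto
  moreover have "countable (\<int> :: real set)" by (auto simp: Ints_def)
  ultimately show ?thesis
    by (meson countable_UN countable_finite countable_subset finite.emptyI finite.insertI)
qed auto

lemma norm_add_cis_squared:
  "(cmod (A + of_real c * cis t))\<^sup>2 = (cmod A)\<^sup>2 + c\<^sup>2 + 2 * c * cmod A * cos (t - Arg A)"
proof -
  have "A = of_real (cmod A) * cis (Arg A)"
    by (metis rcis_cmod_Arg rcis_def)
  then have 1: "Re A = cmod A * cos (Arg A)" "Im A = cmod A * sin (Arg A)"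
    by (metis Re_complex_of_real complex_of_real_mult_Complex cis.code complex.sel)+
  have "(cmod (A + of_real c * cis t))\<^sup>2 = ((Re A)\<^sup>2 + (Im A)\<^sup>2) + c\<^sup>2 * ((cos t)\<^sup>2 + (sin t)\<^sup>2)
     + 2 * c * (Re A * cos t + Im A * sin t)"
    unfolding cmod_power2 by (simp add: power2_eq_square algebra_simps del: sin_cos_squared_add sin_cos_squared_add2 sin_cos_squared_add3)
  then show ?thesis
    unfolding cmod_power2[symmetric] cos_diff by (simp add: 1 algebra_simps)
qed

lemma countable_norm_circle_eq:
  assumes "A \<noteq> 0" "c \<noteq> 0"
  shows "countable {t. cmod (A + of_real c * cis t) = r}"
proof -
  let ?v = "(r\<^sup>2 - (cmod A)\<^sup>2 - c\<^sup>2) / (2 * c * cmod A)"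
  have "{t. cmod (A + of_real c * cis t) = r} \<subseteq> (\<lambda>t. t + Arg A) ` {t. cos t = ?v}"
  proof
    fix t assume "t \<in> {t. cmod (A + of_real c * cis t) = r}"
    then have "r\<^sup>2 = (cmod A)\<^sup>2 + c\<^sup>2 + 2 * c * cmod A * cos (t - Arg A)"
      using norm_add_cis_squared[of A c t] by simp
    then have "cos (t - Arg A) = ?v" using assms by (simp add: field_simps)
    then show "t \<in> (\<lambda>t. t + Arg A) ` {t. cos t = ?v}" by (auto intro!: image_eqI[of _ _ "t - Arg A"])
  qed
  then show ?thesis
    by (rule countable_subset) (intro countable_image countable_cos_eq)
qed

lemma AE_circle_ne_0:
  assumes "a \<noteq> 0"
  shows "AE t in lborel. 1 + of_real a * cis t \<noteq> 0"
proof -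
  have "{t. 1 + of_real a * cis t = 0} \<subseteq> {t. cos t = - 1 / a}"
    using assms by (auto simp: complex_eq_iff field_simps)
  then have "countable {t. 1 + of_real a * cis t = 0}"
    using countable_cos_eq countable_subset by blast
  then show ?thesis
    by (intro AE_I'[OF countable_imp_null_set_lborel]) auto
qed

text \<open>Null on almost every fibre: a circle with nonzero centre reaches a given distance from
  the origin only countably often. This disposes of the case excluded in Jensen's formula and of the
  kink of the maximum.\<close>

lemma AE_two_circles_ne:
  assumes "a \<noteq> 0" "c \<noteq> 0"
  shows "AE p in lborel. cmod (1 + of_real a * cis (fst p) + of_real c * cis (snd p)) \<noteq> r"
  unfolding lborel_prod[symmetric]
proof (rule lborel_pair.AE_pair_measure)
  have [measurable]: "cis \<in> borel_measurable borel"
    by (intro borel_measurable_continuous_onI continuous_intros)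
  show "{p \<in> space (lborel \<Otimes>\<^sub>M lborel). cmod (1 + of_real a * cis (fst p) + of_real c * cis (snd p)) \<noteq> r}
      \<in> sets (lborel \<Otimes>\<^sub>M lborel :: (real \<times> real) measure)"
    by measurable
  have "AE t in lborel. 1 + of_real a * cis t \<noteq> 0"
    by (rule AE_circle_ne_0[OF assms(1)])
  then show "AE x in lborel. AE y in lborel. cmod (1 + of_real a * cis (fst (x, y)) + of_real c * cis (snd (x, y))) \<noteq> r"
  proof eventually_elim
    case (elim x)
    from countable_norm_circle_eq[OF this \<open>c \<noteq> 0\<close>, of r]
    show ?case
      by (intro AE_I'[OF countable_imp_null_set_lborel]) (auto simp: add_ac)
  qed
qed

section \<open>Arcs of a circle inside a disc\<close>

lemma has_integral_periodic_shift:
  fixes f :: "real \<Rightarrow> real"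
  assumes f: "(f has_integral I) {0..p}" and per: "\<And>x. f (x + p) = f x" and d: "0 \<le> d" "d \<le> p"
  shows "((\<lambda>x. f (x + d)) has_integral I) {0..p}"
proof -
  have "f integrable_on {0..d}" "f integrable_on {d..p}"
    using f d by (auto intro: integrable_on_subinterval)
  then obtain I1 I2 where I1: "(f has_integral I1) {0..d}" and I2: "(f has_integral I2) {d..p}"
    by (auto simp: integrable_on_def)
  have I: "I = I2 + I1"
    using has_integral_combine[OF d I1 I2] f has_integral_unique by (metis add.commute)
  have "((\<lambda>x. f (x + d)) has_integral I2) {0..p - d}"
    using has_integral_shift_Icc_real[of f d I2 0 "p - d"] I2 by (simp add: o_def add.commute)
  moreover have "((\<lambda>x. f (x + (d - p))) has_integral I1) {p - d..p}"
    using has_integral_shift_Icc_real[of f "d - p" I1 "p - d" p] I1 by (simp add: o_def add.commute)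
  then have "((\<lambda>x. f (x + d)) has_integral I1) {p - d..p}"
    using per[of "x + d - p" for x] by (simp add: algebra_simps)
  ultimately show ?thesis
    using has_integral_combine[of 0 "p - d" p "\<lambda>x. f (x + d)" I2 I1] d I by simp
qed

text \<open>With the clamp, \<open>arccos\<close> yields 0 when the circle misses the disc and
  \<open>pi\<close> when it lies inside, so one formula covers all positions.\<close>

definition clamp1 :: "real \<Rightarrow> real" where
  "clamp1 v = max (-1) (min 1 v)"

lemma clamp1_bounds [simp]: "-1 \<le> clamp1 v" "clamp1 v \<le> 1"
  by (auto simp: clamp1_def)

text \<open>For v in [-1, 1] the set is the arc symmetric about \<open>pi\<close> that starts at
  arccos (-v); its length 2 pi - 2 arccos (-v) equals 2 arccos v.\<close>

lemma has_integral_cos_less: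
  "((\<lambda>t. if cos t < - v then 1 else 0) has_integral 2 * arccos (clamp1 v)) {0..2 * pi}"
proof -
  consider "v > 1" | "v < -1" | "-1 \<le> v" "v \<le> 1" by linarith
  then show ?thesis
  proof cases
    case 1
    then have "\<not> cos t < - v" for t using cos_ge_minus_one[of t] by linarith
    then show ?thesis using 1 by (simp add: clamp1_def)
  next
    case 2
    then have "cos t < - v" for t using cos_le_one[of t] by linarith
    then show ?thesis using 2 has_integral_const_real[of "1::real" 0 "2*pi"] by (simp add: clamp1_def)
  next
    case 3
    let ?e = "arccos (- v)"
    have e: "0 \<le> ?e" "?e \<le> pi" "cos ?e = - v"
      using 3 by (auto intro: arccos_lbound arccos_ubound)
    have iff: "cos t < - v \<longleftrightarrow> t \<in> {?e<..<2 * pi - ?e}" if "t \<in> {0..2 * pi}" for t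
    proof (cases "t \<le> pi")
      case True
      then show ?thesis using that e cos_mono_less_eq[of t ?e] by auto
    next
      case False
      then have "cos t = cos (2 * pi - t)" by (simp add: cos_diff)
      then show ?thesis using that e False cos_mono_less_eq[of "2 * pi - t" ?e] by auto
    qed
    have "((\<lambda>t. 1) has_integral (2 * pi - ?e - ?e)) {?e..2 * pi - ?e}"
      using has_integral_const_real[of "1::real" ?e "2*pi - ?e"] e by simp
    then have "((\<lambda>t. 1) has_integral (2 * pi - ?e - ?e)) {?e<..<2 * pi - ?e}"
      by (simp add: has_integral_Icc_iff_Ioo)
    then have "((\<lambda>t. if t \<in> {?e<..<2 * pi - ?e} then 1 else 0) has_integral (2 * pi - ?e - ?e)) {0..2 * pi}"
      using e by (subst has_integral_restrict) auto
    then have "((\<lambda>t. if cos t < - v then 1 else 0) has_integral (2 * pi - ?e - ?e)) {0..2 * pi}"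
      by (rule has_integral_eq[rotated]) (simp only: iff)
    then show ?thesis using 3 by (simp add: clamp1_def arccos_minus)
  qed
qed

lemma norm_add_cis_less_iff:
  assumes "A \<noteq> 0" "c > 0" "r > 0"
  shows "cmod (A + of_real c * cis t) < r \<longleftrightarrow>
    cos (t - Arg A) < - (((cmod A)\<^sup>2 + c\<^sup>2 - r\<^sup>2) / (2 * c * cmod A))"
proof -
  have "cmod (A + of_real c * cis t) < r \<longleftrightarrow> (cmod (A + of_real c * cis t))\<^sup>2 < r\<^sup>2"
    using assms by (auto intro: power2_less_imp_less power_strict_mono)
  also have "\<dots> \<longleftrightarrow> cos (t - Arg A) < - (((cmod A)\<^sup>2 + c\<^sup>2 - r\<^sup>2) / (2 * c * cmod A))"
    unfolding norm_add_cis_squared using assms by (simp add: field_simps)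
  finally show ?thesis .
qed

lemma has_integral_norm_add_cis_less:
  assumes "A \<noteq> 0" "c > 0" "r > 0"
  shows "((\<lambda>t. if cmod (A + of_real c * cis t) < r then 1 else 0) has_integral
    2 * arccos (clamp1 (((cmod A)\<^sup>2 + c\<^sup>2 - r\<^sup>2) / (2 * c * cmod A)))) {0..2 * pi}"
proof -
  let ?v = "((cmod A)\<^sup>2 + c\<^sup>2 - r\<^sup>2) / (2 * c * cmod A)"
  \<comment> \<open>The representative of - Arg A modulo 2 pi in [0, 2 pi], as the periodic shift
    requires.\<close>
  define d where "d = (if Arg A \<le> 0 then - Arg A else 2 * pi - Arg A)"
  have d: "0 \<le> d" "d \<le> 2 * pi"
    using mpi_less_Arg[of A] Arg_le_pi[of A] by (auto simp: d_def)
  have "cos (t + d) = cos (t - Arg A)" for t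
    by (auto simp: d_def cos_diff cos_add sin_diff algebra_simps)
  then have "((\<lambda>t. if cos (t - Arg A) < - ?v then 1 else 0) has_integral
    2 * arccos (clamp1 ?v)) {0..2 * pi}"
    using has_integral_periodic_shift[OF has_integral_cos_less[of ?v] _ d] by simp
  then show ?thesis using norm_add_cis_less_iff[OF assms] by simp
qed

lemma has_integral_cos_double:
  fixes f :: "real \<Rightarrow> real"
  assumes "((\<lambda>t. f (cos t)) has_integral I) {0..pi}"
  shows "((\<lambda>t. f (cos t)) has_integral 2 * I) {0..2 * pi}"
proof -
  have "((\<lambda>t. f (cos (- t))) has_integral I) {- pi..0}"
    using assms by (subst has_integral_reflect_real[where a = 0, simplified])
  then have "((\<lambda>t. f (cos t)) has_integral I) {-pi + 2 * pi .. 0 + 2 * pi}"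
    using has_integral_shift_Icc_real[of "\<lambda>t. f (cos t)" "2 * pi" I "- pi" 0] by (simp add: o_def cos_add)
  then show ?thesis
    using has_integral_combine[OF _ _ assms, of "2 * pi" I] by simp
qed

section \<open>The Ronkin function as a two-dimensional mean\<close>

lemma borel_measurable_cis [measurable]: "cis \<in> borel_measurable borel"
  by (intro borel_measurable_continuous_onI continuous_intros)

lemma Basis_real3: "(Basis :: (real \<times> real \<times> real) set) = {(1, 0, 0), (0, 1, 0), (0, 0, 1)}"
  by (auto simp: Basis_prod_def zero_prod_def)

lemma lborel_distr_swap3:
  "distr lborel borel (\<lambda>(x, y, z). (y, x, z)) = (lborel :: (real \<times> real \<times> real) measure)"
proof (rule lborel_eqI[symmetric])
  fix l u :: "real \<times> real \<times> real"
  assume le: "\<And>b. b \<in> Basis \<Longrightarrow> l \<bullet> b \<le> u \<bullet> b"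
  obtain l1 l2 l3 u1 u2 u3 where lu: "l = (l1, l2, l3)" "u = (u1, u2, u3)"
    by (cases l, cases u) auto
  have [measurable]: "(\<lambda>(x, y, z). (y, x, z)) \<in> (borel :: (real \<times> real \<times> real) measure) \<rightarrow>\<^sub>M borel"
    by (intro borel_measurable_continuous_onI) (auto simp: case_prod_beta intro!: continuous_intros)
  have "(\<lambda>(x, y, z). (y, x, z)) -` box l u = box (l2, l1, l3) (u2, u1, u3)"
    by (auto simp: box_def Basis_real3 lu)
  then show "emeasure (distr lborel borel (\<lambda>(x, y, z). (y, x, z))) (box l u) = ennreal (\<Prod>b\<in>Basis. (u - l) \<bullet> b)"
    using le[of "(1, 0, 0)"] le[of "(0, 1, 0)"] le[of "(0, 0, 1)"]
    by (simp add: emeasure_distr emeasure_lborel_box_eq Basis_real3 lu mult_ac)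
qed simp

text \<open>Reduces the \<open>y\<close>-derivative to the \<open>x\<close>-derivative.\<close>

lemma ronkin_lin_poly_swap: "ronkin lin_poly (x, y, u) = ronkin lin_poly (y, x, u)"
proof -
  let ?A = "{0..2 * pi} \<times> {0..2 * pi} \<times> {0..2 * pi} :: (real \<times> real \<times> real) set"
  let ?f = "\<lambda>x y (t, p, q). indicator ?A (t, p, q) *\<^sub>R ln (cmod (lin_poly (of_real (exp x) * cis t, of_real (exp y) * cis p, of_real (exp u) * cis q)))"
  have [measurable]: "(\<lambda>(x, y, z). (y, x, z)) \<in> (borel :: (real \<times> real \<times> real) measure) \<rightarrow>\<^sub>M borel"
    by (intro borel_measurable_continuous_onI) (auto simp: case_prod_beta intro!: continuous_intros)
  have meas: "?f x y \<in> borel_measurable borel"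
  proof -
    have "(\<lambda>z. cmod (1 + of_real (exp x) * cis (fst z) + of_real (exp y) * cis (fst (snd z))
        + of_real (exp u) * cis (snd (snd z)))) \<in> borel_measurable (borel :: (real \<times> real \<times> real) measure)"
      by (intro borel_measurable_continuous_onI continuous_intros)
    then have "(\<lambda>z. indicator ?A z *\<^sub>R ln (cmod (1 + of_real (exp x) * cis (fst z) + of_real (exp y) * cis (fst (snd z))
        + of_real (exp u) * cis (snd (snd z))))) \<in> borel_measurable (borel :: (real \<times> real \<times> real) measure)"
      by (intro borel_measurable_scaleR borel_measurable_indicator borel_measurable_ln borel_closed closed_Times) auto
    moreover have "?f x y = (\<lambda>z. indicator ?A z *\<^sub>R ln (cmod (1 + of_real (exp x) * cis (fst z) + of_real (exp y) * cis (fst (snd z))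
        + of_real (exp u) * cis (snd (snd z)))))"
      by (auto simp: fun_eq_iff lin_poly_def)
    ultimately show ?thesis
      by (simp only:)
  qed
  have "(LINT p|lborel. ?f x y p) = (LINT p|distr lborel borel (\<lambda>(x, y, z). (y, x, z)). ?f x y p)"
    by (simp add: lborel_distr_swap3)
  also have "\<dots> = (LINT p|lborel. ?f y x p)"
    by (subst integral_distr[OF _ meas])
      (auto intro!: Bochner_Integration.integral_cong simp: lin_poly_def add_ac indicator_def)
  finally show ?thesis
    by (simp add: ronkin_def set_lebesgue_integral_def case_prod_beta)
qed

abbreviation full_turn :: "real set" where
  "full_turn \<equiv> {0..2 * pi}"

lemma square_borel [measurable]: "full_turn \<times> full_turn \<in> sets (borel :: (real \<times> real) measure)"
  by (intro borel_closed closed_Times) auto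

lemma square_integrable_continuous:
  fixes f :: "real \<times> real \<Rightarrow> real"
  assumes "continuous_on UNIV f"
  shows "set_integrable lborel (full_turn \<times> full_turn) f"
proof -
  have "full_turn \<times> full_turn = cbox (0, 0) (2 * pi, 2 * pi)"
    by (simp add: cbox_Pair_eq)
  then show ?thesis
    unfolding set_integrable_def
    using borel_integrable_compact[of "full_turn \<times> full_turn" f] assms compact_cbox[of "(0, 0)" "(2 * pi, 2 * pi)"]
    by (auto intro: continuous_on_subset)
qed

lemma ronkin_integrable:
  fixes a b c :: real
  assumes a: "a > 0" and b: "b > 0" and c: "c > 0"
  defines "F \<equiv> (\<lambda>(p, t). indicator (full_turn \<times> full_turn) p * (indicator full_turn t *
     ln (cmod (1 + of_real b * cis (fst p) + of_real c * cis (snd p) + of_real a * cis t))))"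
  shows "integrable (lborel \<Otimes>\<^sub>M lborel) F"
    and "(LINT z|(lborel \<Otimes>\<^sub>M lborel). F z) =
     2 * pi * (LINT p:full_turn \<times> full_turn|lborel. ln (max (cmod (1 + of_real b * cis (fst p) + of_real c * cis (snd p))) a))"
proof -
  define A where "A p = 1 + of_real b * cis (fst p) + of_real c * cis (snd p)" for p :: "real \<times> real"
  \<comment> \<open>An upper bound for the logarithm, from ln v <= v and the triangle inequality. It
    is positive, so it also dominates the default value ln 0 = 0.\<close>
  define C where "C = 1 + a + b + c"
  define G where "G = (\<lambda>(p, t). indicator (full_turn \<times> full_turn) p * (indicator full_turn t * (C - ln (cmod (A p + of_real a * cis t)))))"
  define L where "L p = ln (max (cmod (A p)) a)" for p
  have contA: "continuous_on UNIV A"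
    unfolding A_def by (intro continuous_intros)
  then have [measurable]: "A \<in> borel_measurable borel"
    by (rule borel_measurable_continuous_onI)
  have normA: "cmod (A p) \<le> 1 + b + c" for p
    unfolding A_def using b c by (intro norm_triangle_le add_mono) (auto simp: norm_mult)
  have contL: "continuous_on UNIV L"
    unfolding L_def using a contA by (intro continuous_intros contA) auto
  then have [measurable]: "L \<in> borel_measurable borel"
    by (rule borel_measurable_continuous_onI)
  have intL: "set_integrable lborel (full_turn \<times> full_turn) L"
    by (rule square_integrable_continuous[OF contL])
  have int1: "set_integrable lborel (full_turn \<times> full_turn) (\<lambda>p. 1 :: real)"
    by (rule square_integrable_continuous) auto
  have [measurable]: "G \<in> borel_measurable (lborel \<Otimes>\<^sub>M lborel)"
    unfolding G_def by measurable
  have nonneg: "ln (cmod (A p + of_real a * cis t)) \<le> C" for p t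
  proof (cases "A p + of_real a * cis t = 0")
    case False
    then have "ln (cmod (A p + of_real a * cis t)) \<le> cmod (A p + of_real a * cis t)"
      using ln_le_minus_one[of "cmod (A p + of_real a * cis t)"] by simp
    also have "\<dots> \<le> cmod (A p) + a"
      using norm_triangle_ineq[of "A p" "of_real a * cis t"] a by (simp add: norm_mult)
    finally show ?thesis using normA[of p] by (simp add: C_def)
  qed (use a b c in \<open>auto simp: C_def\<close>)
  have G0: "0 \<le> G z" for z
    using nonneg by (auto simp: G_def case_prod_beta indicator_def)
  have ae: "AE p in lborel. cmod (A p) \<noteq> a"
    unfolding A_def using AE_two_circles_ne[of b c a] b c by simp
  have inner: "set_integrable lborel full_turn (\<lambda>t. ln (cmod (A p + of_real a * cis t)))"
    "(LINT t:full_turn|lborel. ln (cmod (A p + of_real a * cis t))) = 2 * pi * L p" if "cmod (A p) \<noteq> a" for p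
  proof -
    show 1: "set_integrable lborel full_turn (\<lambda>t. ln (cmod (A p + of_real a * cis t)))"
      using jensen_circle(2)[OF a that] by (intro borel_integrable_atLeastAtMost') (auto intro: continuous_on_subset)
    show "(LINT t:full_turn|lborel. ln (cmod (A p + of_real a * cis t))) = 2 * pi * L p"
      unfolding set_borel_integral_eq_integral[OF 1] L_def
      by (rule integral_unique[OF jensen_circle(1)[OF a that]])
  qed
  have intC: "set_integrable lborel full_turn (\<lambda>t. C)"
    by (intro borel_integrable_atLeastAtMost') auto
  have Gi: "integrable lborel (\<lambda>t. G (p, t))"
    "(LINT t|lborel. G (p, t)) = indicator (full_turn \<times> full_turn) p * (2 * pi * C - 2 * pi * L p)" if "cmod (A p) \<noteq> a" for p
  proof -
    have "set_integrable lborel full_turn (\<lambda>t. C - ln (cmod (A p + of_real a * cis t)))"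
      by (intro set_integral_diff intC inner that)
    then show "integrable lborel (\<lambda>t. G (p, t))"
      unfolding G_def case_prod_conv set_integrable_def by (intro integrable_mult_right) simp
    have "(LINT t:full_turn|lborel. C - ln (cmod (A p + of_real a * cis t))) = 2 * pi * C - 2 * pi * L p"
      by (subst set_integral_diff) (use intC inner[OF that] in \<open>auto simp: set_lebesgue_integral_def\<close>)
    then show "(LINT t|lborel. G (p, t)) = indicator (full_turn \<times> full_turn) p * (2 * pi * C - 2 * pi * L p)"
      unfolding G_def case_prod_conv set_lebesgue_integral_def by simp
  qed
  have "integrable (lborel \<Otimes>\<^sub>M lborel) G"
  proof (rule lborel_pair.Fubini_integrable)
    \<comment> \<open>\<open>G\<close> is nonnegative, so Jensen's formula computes its absolute inner integrals;
      the logarithmic singularities need no estimate.\<close>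
    have "set_integrable lborel (full_turn \<times> full_turn) (\<lambda>p. C * 2 * pi - 2 * pi * L p)"
      using set_integral_diff(1)[OF set_integrable_mult_right[OF int1, of "2 * pi * C"] set_integrable_mult_right[OF intL, of "2 * pi"]]
      by (simp add: mult_ac)
    then have "integrable lborel (\<lambda>p. indicator (full_turn \<times> full_turn) p * (2 * pi * C - 2 * pi * L p))"
      by (simp add: set_integrable_def mult_ac)
    then show "integrable lborel (\<lambda>p. LINT t|lborel. norm (G (p, t)))"
      using ae Gi(2) G0 by (subst integrable_cong_AE) (auto elim!: eventually_mono)
    show "AE p in lborel. integrable lborel (\<lambda>t. G (p, t))"
      using ae by eventually_elim (rule Gi)
  qed simp
  moreover have "integrable (lborel \<Otimes>\<^sub>M lborel) (\<lambda>(p, t). indicator (full_turn \<times> full_turn) p * (indicator full_turn t * C))"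
  proof -
    have "set_integrable lborel (cbox ((0, 0), 0) ((2 * pi, 2 * pi), 2 * pi)) (\<lambda>z :: (real \<times> real) \<times> real. C)"
      unfolding set_integrable_def by (intro borel_integrable_compact continuous_intros) auto
    then show ?thesis
      unfolding lborel_prod set_integrable_def
      by (rule Bochner_Integration.integrable_cong[THEN iffD1, OF refl, rotated])
         (auto simp: indicator_def cbox_Pair_eq)
  qed
  ultimately have "integrable (lborel \<Otimes>\<^sub>M lborel) (\<lambda>z. (\<lambda>(p, t). indicator (full_turn \<times> full_turn) p * (indicator full_turn t * C)) z - G z)"
    by (rule Bochner_Integration.integrable_diff[rotated])
  then show F: "integrable (lborel \<Otimes>\<^sub>M lborel) F"
    by (rule Bochner_Integration.integrable_cong[THEN iffD1, OF refl, rotated])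
       (auto simp: F_def G_def A_def algebra_simps)
  have "(LINT z|(lborel \<Otimes>\<^sub>M lborel). F z) = (LINT p|lborel. LINT t|lborel. F (p, t))"
    using lborel_pair.integral_fst'[OF F] by simp
  also have "\<dots> = (LINT p|lborel. indicator (full_turn \<times> full_turn) p * (2 * pi * L p))"
  proof (rule integral_cong_AE)
    show "(\<lambda>p. LINT t|lborel. F (p, t)) \<in> borel_measurable lborel"
      using F by measurable
    show "AE p in lborel. (LINT t|lborel. F (p, t)) = indicator (full_turn \<times> full_turn) p * (2 * pi * L p)"
      using ae
    proof eventually_elim
      case (elim p)
      show ?case
        using inner(2)[OF elim] by (simp add: F_def set_lebesgue_integral_def A_def mult.assoc)
    qed
  qed measurable
  also have "\<dots> = 2 * pi * (LINT p:full_turn \<times> full_turn|lborel. L p)"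
    by (simp add: set_lebesgue_integral_def mult.left_commute)
  finally show "(LINT z|(lborel \<Otimes>\<^sub>M lborel). F z) =
     2 * pi * (LINT p:full_turn \<times> full_turn|lborel. ln (max (cmod (1 + of_real b * cis (fst p) + of_real c * cis (snd p))) a))"
    by (simp add: L_def A_def)
qed

text \<open>Jensen's formula is applied to the angle of \<open>z\<close>, so that \<open>x\<close>
  survives only inside the maximum.\<close>

lemma ronkin_lin_poly_eq:
  "ronkin lin_poly (x, y, u) = 1 / (4 * pi\<^sup>2) *
     (LINT p:full_turn \<times> full_turn|lborel. ln (max (cmod (1 + of_real (exp y) * cis (fst p) + of_real (exp u) * cis (snd p))) (exp x)))"
    (is "_ = _ * ?I")
proof -
  let ?F = "\<lambda>(p, t). indicator (full_turn \<times> full_turn) p * (indicator full_turn t *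
     ln (cmod (1 + of_real (exp y) * cis (fst p) + of_real (exp u) * cis (snd p) + of_real (exp x) * cis t)))"
  have "(LINT (\<theta>, \<phi>, \<psi>) : full_turn \<times> full_turn \<times> full_turn | lborel.
        ln (cmod (lin_poly (of_real (exp x) * cis \<theta>, of_real (exp y) * cis \<phi>, of_real (exp u) * cis \<psi>))))
     = (LINT (t, p)|(lborel \<Otimes>\<^sub>M lborel). ?F (p, t))"
    unfolding set_lebesgue_integral_def lborel_prod
    by (intro Bochner_Integration.integral_cong) (auto simp: indicator_def lin_poly_def add_ac)
  also have "\<dots> = (LINT z|(lborel \<Otimes>\<^sub>M lborel). ?F z)"
    by (intro lborel_pair.integral_product_swap borel_measurable_integrable ronkin_integrable) auto
  also have "\<dots> = 2 * pi * ?I"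
    by (rule ronkin_integrable(2)) auto
  finally have "ronkin lin_poly (x, y, u) = (1 / (2 * pi)) ^ 3 * (2 * pi * ?I)"
    unfolding ronkin_def case_prod_conv by simp
  then show ?thesis
    by (simp add: power3_eq_cube power2_eq_square field_simps)
qed

text \<open>As a function of \<open>x\<close> the integrand is max x (ln m): Lipschitz with constant
  1, and differentiable off the null set where \<open>m p = exp x\<close>. Dominated convergence
  applies to the difference quotients.\<close>

lemma torus_mean_has_derivative:
  assumes b: "b > 0" and c: "c > 0"
  defines "m \<equiv> (\<lambda>p. cmod (1 + of_real b * cis (fst p) + of_real c * cis (snd p)))"
  shows "((\<lambda>x. LINT p:full_turn \<times> full_turn|lborel. ln (max (m p) (exp x))) has_real_derivative
     (LINT p:full_turn \<times> full_turn|lborel. if m p < exp x then 1 else 0)) (at x)"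
proof -
  define L where "L x p = ln (max (m p) (exp x))" for x p
  have m0: "m p \<ge> 0" for p by (simp add: m_def)
  have contm: "continuous_on UNIV m"
    unfolding m_def by (intro continuous_intros)
  then have [measurable]: "m \<in> borel_measurable borel"
    by (rule borel_measurable_continuous_onI)
  have contL: "continuous_on UNIV (L x)" for x
    unfolding L_def by (intro continuous_intros contm) (auto simp: max_def m0 not_less)
  then have [measurable]: "L x \<in> borel_measurable borel" for x
    by (rule borel_measurable_continuous_onI)
  have intL: "set_integrable lborel (full_turn \<times> full_turn) (L x)" for x
    by (rule square_integrable_continuous[OF contL])
  have Lcases: "L x p = (if m p \<le> exp x then x else ln (m p))" for x p
    by (auto simp: L_def max_def)
  \<comment> \<open>The case \<open>m p = 0\<close> is separate because \<open>ln 0\<close> is 0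
    here and not minus infinity.\<close>
  have Lmax: "L x p = (if m p = 0 then x else max x (ln (m p)))" for x p
    using m0[of p] ln_ge_iff[of "m p" x] by (auto simp: Lcases max_def not_le)
  have lip: "\<bar>L x p - L y p\<bar> \<le> \<bar>x - y\<bar>" for x y p
    by (auto simp: Lmax)
  have ae: "AE p in lborel. m p \<noteq> exp x"
    unfolding m_def using AE_two_circles_ne[of b c "exp x"] b c by simp
  have deriv: "((\<lambda>x. L x p) has_real_derivative (if m p < exp x then 1 else 0)) (at x)" if "m p \<noteq> exp x" for p
  proof (cases "m p < exp x")
    case True
    have "open {s. m p < exp s}" by (intro open_Collect_less continuous_intros)
    then have "\<forall>\<^sub>F s in nhds x. m p < exp s"
      using True eventually_nhds_in_open by fastforce
    then have "\<forall>\<^sub>F s in nhds x. L s p = s"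
      by eventually_elim (simp add: Lcases)
    then show ?thesis using True by (subst DERIV_cong_ev) auto
  next
    case False
    then have "exp x < m p" using that by simp
    moreover have "open {s. exp s < m p}" by (intro open_Collect_less continuous_intros)
    ultimately have "\<forall>\<^sub>F s in nhds x. exp s < m p"
      using eventually_nhds_in_open by fastforce
    then have "\<forall>\<^sub>F s in nhds x. L s p = ln (m p)"
      by eventually_elim (simp add: Lcases)
    then show ?thesis using False by (subst DERIV_cong_ev) auto
  qed
  have "((\<lambda>y. ((LINT p:full_turn \<times> full_turn|lborel. L y p) - (LINT p:full_turn \<times> full_turn|lborel. L x p)) / (y - x)) \<longlongrightarrow>
     (LINT p:full_turn \<times> full_turn|lborel. if m p < exp x then 1 else 0)) (at x)"
    unfolding tendsto_at_iff_sequentially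
  proof (intro allI impI)
    fix X :: "nat \<Rightarrow> real"
    assume X: "\<forall>i. X i \<in> UNIV - {x}" "X \<longlonglongrightarrow> x"
    have "(\<lambda>i. LINT p|lborel. indicator (full_turn \<times> full_turn) p *\<^sub>R ((L (X i) p - L x p) / (X i - x))) \<longlonglongrightarrow>
      (LINT p|lborel. indicator (full_turn \<times> full_turn) p *\<^sub>R (if m p < exp x then 1 else 0))"
    proof (rule integral_dominated_convergence[where w = "\<lambda>p. indicator (full_turn \<times> full_turn) p *\<^sub>R 1"])
      show "integrable lborel (\<lambda>p. indicat_real (full_turn \<times> full_turn) p *\<^sub>R 1)"
        using square_integrable_continuous[of "\<lambda>_. 1"] by (simp add: set_integrable_def)
      show "AE p in lborel. (\<lambda>i. indicat_real (full_turn \<times> full_turn) p *\<^sub>R ((L (X i) p - L x p) / (X i - x))) \<longlonglongrightarrow>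
        indicat_real (full_turn \<times> full_turn) p *\<^sub>R (if m p < exp x then 1 else 0)"
        using ae
      proof eventually_elim
        case (elim p)
        have "((\<lambda>y. (L y p - L x p) / (y - x)) \<longlongrightarrow> (if m p < exp x then 1 else 0)) (at x)"
          using deriv[OF elim] unfolding has_field_derivative_iff .
        then have "(\<lambda>i. (L (X i) p - L x p) / (X i - x)) \<longlonglongrightarrow> (if m p < exp x then 1 else 0)"
          using X unfolding tendsto_at_iff_sequentially o_def by blast
        then show ?case by (intro tendsto_intros)
      qed
      show "AE p in lborel. norm (indicat_real (full_turn \<times> full_turn) p *\<^sub>R ((L (X i) p - L x p) / (X i - x))) \<le> indicat_real (full_turn \<times> full_turn) p *\<^sub>R 1" for i
        using lip[of "X i" _ x] X(1) by (intro AE_I2) (auto simp: indicator_def divide_simps)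
    qed measurable
    moreover have "(LINT p|lborel. indicator (full_turn \<times> full_turn) p *\<^sub>R ((L (X i) p - L x p) / (X i - x))) =
       ((LINT p:full_turn \<times> full_turn|lborel. L (X i) p) - (LINT p:full_turn \<times> full_turn|lborel. L x p)) / (X i - x)" for i
      using set_integral_diff(2)[OF intL intL, of "X i" x, symmetric]
      by (simp add: set_lebesgue_integral_def)
    ultimately show "((\<lambda>y. ((LINT p:full_turn \<times> full_turn|lborel. L y p) - (LINT p:full_turn \<times> full_turn|lborel. L x p)) / (y - x)) \<circ> X) \<longlonglongrightarrow>
     (LINT p:full_turn \<times> full_turn|lborel. if m p < exp x then 1 else 0)"
      unfolding o_def by (simp only: set_lebesgue_integral_def)
  qed
  then show ?thesis unfolding has_field_derivative_iff L_def .
qed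

section \<open>First derivatives as mean angles of a triangle\<close>

definition side2 :: "real \<Rightarrow> real \<Rightarrow> real" where
  "side2 Q t = 1 + Q\<^sup>2 + 2 * Q * cos t"

text \<open>
  By the law of cosines, \<open>cosine r s R\<close> is the cosine of the angle opposite the side \<open>r\<close> in the triangle
  with sides \<open>r\<close>, \<open>s\<close> and \<open>sqrt R\<close>; it leaves \<open>[-1, 1]\<close> exactly when there is no such triangle.
\<close>

definition cosine :: "real \<Rightarrow> real \<Rightarrow> real \<Rightarrow> real" where
  "cosine r s R = (R + s\<^sup>2 - r\<^sup>2) / (2 * s * sqrt R)"

definition mean_angle :: "real \<Rightarrow> real \<Rightarrow> real \<Rightarrow> real" where
  "mean_angle Q r s = integral {0..pi} (\<lambda>t. arccos (clamp1 (cosine r s (side2 Q t))))"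

lemma side2_cmod: "(cmod (1 + of_real Q * cis t))\<^sup>2 = side2 Q t"
proof -
  have "(cmod (1 + of_real Q * cis t))\<^sup>2 = 1 + Q\<^sup>2 * ((sin t)\<^sup>2 + (cos t)\<^sup>2) + 2 * Q * cos t"
    unfolding cmod_power2 by (simp add: power2_eq_square algebra_simps del: sin_cos_squared_add sin_cos_squared_add2 sin_cos_squared_add3)
  then show ?thesis by (simp add: side2_def)
qed

lemma continuous_side2 [continuous_intros]: "continuous_on A (side2 Q)"
  unfolding side2_def by (intro continuous_intros)

lemma borel_measurable_side2 [measurable]: "side2 Q \<in> borel_measurable borel"
  by (intro borel_measurable_continuous_onI continuous_intros)

lemma borel_measurable_arccos_clamp1 [measurable]: "(\<lambda>v. arccos (clamp1 v)) \<in> borel_measurable borel"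
  unfolding clamp1_def
  by (intro borel_measurable_continuous_onI continuous_intros) auto

lemma set_integrable_angle: "set_integrable lborel {u..v} (\<lambda>t. arccos (clamp1 (cosine r s (side2 Q t))))"
proof -
  have [measurable]: "(\<lambda>t. arccos (clamp1 (cosine r s (side2 Q t)))) \<in> borel_measurable borel"
    unfolding cosine_def
    by (rule measurable_compose[OF _ borel_measurable_arccos_clamp1]) measurable
  have "set_integrable lborel {u..v} (\<lambda>t. pi)"
    by (intro borel_integrable_atLeastAtMost') auto
  then show ?thesis
    by (rule set_integrable_bound)
      (auto simp: set_borel_measurable_def abs_le_iff arccos_lbound arccos_ubound intro!: order_trans[OF _ arccos_lbound])
qed

text \<open>The factor 4 has two sources: an arc has length twice the angle, and folding the full
  turn onto [0, pi] doubles the integral.\<close>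

lemma area_eq_mean_angle:
  assumes b: "b > 0" and c: "c > 0" and a: "a > 0"
  shows "(LINT p:full_turn \<times> full_turn|lborel. if cmod (1 + of_real b * cis (fst p) + of_real c * cis (snd p)) < a then 1 else 0)
    = 4 * mean_angle b a c"
proof -
  define m where "m p = cmod (1 + of_real b * cis (fst p) + of_real c * cis (snd p))" for p :: "real \<times> real"
  define g where "g p = indicator (full_turn \<times> full_turn) p * (if m p < a then 1 else 0 :: real)" for p
  define \<beta> where "\<beta> t = arccos (clamp1 (cosine a c (side2 b t)))" for t
  have "continuous_on UNIV m"
    unfolding m_def by (intro continuous_intros)
  then have [measurable]: "m \<in> borel_measurable borel"
    by (rule borel_measurable_continuous_onI)
  have [measurable]: "g \<in> borel_measurable borel"
    unfolding g_def by measurable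
  have "integrable lborel (\<lambda>p. indicator (full_turn \<times> full_turn) p * (1 :: real))"
    using square_integrable_continuous[of "\<lambda>_. 1"] by (simp add: set_integrable_def)
  then have gi: "integrable lborel g"
    by (rule Bochner_Integration.integrable_bound) (auto simp: g_def indicator_def)
  have ae: "AE t in lborel. 1 + of_real b * cis t \<noteq> 0"
    using b by (intro AE_circle_ne_0) simp
  have inner: "(LINT q|lborel. g (t, q)) = indicator full_turn t * (2 * \<beta> t)" if "1 + of_real b * cis t \<noteq> 0" for t
  proof -
    have "set_integrable lborel full_turn (\<lambda>q. if m (t, q) < a then 1 else 0 :: real)"
      by (rule set_integrable_bound[of _ _ "\<lambda>_. 1 :: real"])
        (auto simp: set_borel_measurable_def intro!: borel_integrable_atLeastAtMost')
    from set_borel_integral_eq_integral(2)[OF this]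
    have "(LINT q:full_turn|lborel. if m (t, q) < a then 1 else 0) = 2 * \<beta> t"
      using integral_unique[OF has_integral_norm_add_cis_less[OF that c a]]
      by (simp add: \<beta>_def m_def cosine_def side2_cmod[symmetric])
    then show ?thesis
      by (cases "t \<in> full_turn") (simp_all add: g_def set_lebesgue_integral_def indicator_times)
  qed
  have "(LINT p:full_turn \<times> full_turn|lborel. if m p < a then 1 else 0) = (LINT p|(lborel \<Otimes>\<^sub>M lborel). g p)"
    by (simp add: set_lebesgue_integral_def g_def lborel_prod)
  also have "\<dots> = (LINT t|lborel. LINT q|lborel. g (t, q))"
    using lborel_pair.integral_fst'[of g] gi by (simp add: lborel_prod)
  also have "\<dots> = (LINT t|lborel. indicator full_turn t * (2 * \<beta> t))"
  proof (rule integral_cong_AE)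
    show "(\<lambda>t. LINT q|lborel. g (t, q)) \<in> borel_measurable lborel"
      using lborel_pair.integrable_fst'[of g] gi by (simp add: lborel_prod)
    show "AE t in lborel. (LINT q|lborel. g (t, q)) = indicator full_turn t * (2 * \<beta> t)"
      using ae by eventually_elim (rule inner)
    show "(\<lambda>t. indicator full_turn t * (2 * \<beta> t)) \<in> borel_measurable lborel"
      using set_integrable_angle[where u = 0 and v = "2 * pi" and r = a and s = c and Q = b] by (simp add: set_integrable_def \<beta>_def[symmetric] mult.left_commute)
  qed
  also have "\<dots> = 2 * (LINT t:full_turn|lborel. \<beta> t)"
    by (simp add: set_lebesgue_integral_def mult.left_commute)
  also have "(LINT t:full_turn|lborel. \<beta> t) = integral full_turn \<beta>"
    unfolding \<beta>_def by (rule set_borel_integral_eq_integral(2)[OF set_integrable_angle])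
  also have "integral full_turn \<beta> = 2 * mean_angle b a c"
  proof (rule integral_unique)
    let ?f = "\<lambda>v. arccos (clamp1 (cosine a c (1 + b\<^sup>2 + 2 * b * v)))"
    have "((\<lambda>t. ?f (cos t)) has_integral mean_angle b a c) {0..pi}"
      using integrable_integral[OF set_borel_integral_eq_integral(1)[OF set_integrable_angle[where u = 0 and v = pi and r = a and s = c and Q = b]]]
      by (simp add: mean_angle_def side2_def)
    from has_integral_cos_double[OF this]
    show "(\<beta> has_integral 2 * mean_angle b a c) full_turn"
      unfolding \<beta>_def[abs_def] side2_def .
  qed
  finally show ?thesis by (simp add: m_def)
qed

text \<open>Holds at every point, so the first-order clauses in the second partials are immediate
  and all the work lies in differentiating \<open>mean_angle\<close>.\<close>

lemma ronkin_has_derivative_x: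
  "((\<lambda>r. ronkin lin_poly (r, y, u)) has_real_derivative mean_angle (exp y) (exp x) (exp u) / pi\<^sup>2) (at x)"
proof -
  have "((\<lambda>r. ronkin lin_poly (r, y, u)) has_real_derivative 1 / (4 * pi\<^sup>2) * (4 * mean_angle (exp y) (exp x) (exp u))) (at x)"
    unfolding ronkin_lin_poly_eq
    using torus_mean_has_derivative[of "exp y" "exp u" x] area_eq_mean_angle[of "exp y" "exp u" "exp x"]
    by (intro DERIV_cmult) simp
  then show ?thesis by (simp add: field_simps)
qed

lemma ronkin_has_derivative_y:
  "((\<lambda>r. ronkin lin_poly (x, r, u)) has_real_derivative mean_angle (exp x) (exp y) (exp u) / pi\<^sup>2) (at y)"
  using ronkin_has_derivative_x[of x u y] by (simp add: ronkin_lin_poly_swap[of x])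

section \<open>Differentiation of integrals of angles\<close>

lemma clamp1_eq: "\<bar>v\<bar> \<le> 1 \<Longrightarrow> clamp1 v = v"
  by (auto simp: clamp1_def)

text \<open>The clamped angle is continuous throughout, smooth where |h| < 1 and locally constant
  where |h| > 1. The fundamental theorem tolerates the finitely many points with |h| = 1, where the
  integrand may blow up.\<close>

lemma has_integral_arccos_clamp1:
  fixes h h' :: "real \<Rightarrow> real"
  assumes "x \<le> y" and fin: "finite {t \<in> {x..y}. \<bar>h t\<bar> = 1}"
    and der: "\<And>t. t \<in> {x..y} \<Longrightarrow> (h has_real_derivative h' t) (at t)"
  shows "((\<lambda>t. if \<bar>h t\<bar> < 1 then - h' t / sqrt (1 - (h t)\<^sup>2) else 0) has_integral
      arccos (clamp1 (h y)) - arccos (clamp1 (h x))) {x..y}"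
proof (rule fundamental_theorem_of_calculus_interior_strong[OF fin \<open>x \<le> y\<close>])
  have cont: "continuous_on {x..y} h"
    using der DERIV_isCont by (blast intro: continuous_at_imp_continuous_on)
  show "continuous_on {x..y} (\<lambda>t. arccos (clamp1 (h t)))"
    unfolding clamp1_def by (intro continuous_intros cont) auto
  fix t assume t: "t \<in> {x<..<y} - {t \<in> {x..y}. \<bar>h t\<bar> = 1}"
  then have d: "(h has_real_derivative h' t) (at t)"
    using der by auto
  then have isc: "isCont h t"
    by (rule DERIV_isCont)
  have ev: "\<forall>\<^sub>F s in nhds t. P (h s)" if "open {v. P v}" "P (h t)" for P
    using topological_tendstoD[OF isc[unfolded isCont_def tendsto_at_iff_tendsto_nhds] that(1)] that(2) by simp
  consider "\<bar>h t\<bar> < 1" | "h t > 1" | "h t < -1" using t by fastforce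
  then have "((\<lambda>t. arccos (clamp1 (h t))) has_real_derivative
      (if \<bar>h t\<bar> < 1 then - h' t / sqrt (1 - (h t)\<^sup>2) else 0)) (at t)"
  proof cases
    case 1
    have "((\<lambda>t. arccos (h t)) has_real_derivative inverse (- sqrt (1 - (h t)\<^sup>2)) * h' t) (at t)"
      using 1 by (intro DERIV_chain2[of arccos, OF DERIV_arccos d]) auto
    moreover have "\<forall>\<^sub>F s in nhds t. \<bar>h s\<bar> < 1"
      using 1 by (intro ev[of "\<lambda>v. \<bar>v\<bar> < 1"] open_Collect_less continuous_intros)
    then have "\<forall>\<^sub>F s in nhds t. arccos (clamp1 (h s)) = arccos (h s)"
      by eventually_elim (simp add: clamp1_eq)
    ultimately show ?thesis
      using 1 by (subst DERIV_cong_ev[OF refl _ refl]) (auto simp: divide_inverse mult.commute)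
  next
    case 2
    have "\<forall>\<^sub>F s in nhds t. h s > 1"
      using 2 by (intro ev[of "\<lambda>v. v > 1"] open_Collect_less continuous_intros)
    then have "\<forall>\<^sub>F s in nhds t. arccos (clamp1 (h s)) = 0"
      by eventually_elim (simp add: clamp1_def)
    then show ?thesis using 2 by (subst DERIV_cong_ev[OF refl _ refl]) auto
  next
    case 3
    have "\<forall>\<^sub>F s in nhds t. h s < -1"
      using 3 by (intro ev[of "\<lambda>v. v < -1"] open_Collect_less continuous_intros)
    then have "\<forall>\<^sub>F s in nhds t. arccos (clamp1 (h s)) = pi"
      by eventually_elim (simp add: clamp1_def)
    then show ?thesis using 3 by (subst DERIV_cong_ev[OF refl _ refl]) auto
  qed
  then show "((\<lambda>t. arccos (clamp1 (h t))) has_vector_derivative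
      (if \<bar>h t\<bar> < 1 then - h' t / sqrt (1 - (h t)\<^sup>2) else 0)) (at t)"
    by (simp add: has_real_derivative_iff_has_vector_derivative)
qed

text \<open>
  The integrands below have inverse square root singularities whose position moves with the parameter,
  so dominated convergence is not available; Fubini's theorem and the fundamental theorem of calculus are.
\<close>

lemma has_derivative_integral_Fubini:
  fixes \<beta> D :: "real \<Rightarrow> real \<Rightarrow> real"
  assumes x: "x \<in> {l<..<r}"
    and meas: "(\<lambda>(t, \<theta>). D t \<theta>) \<in> borel_measurable (lborel \<Otimes>\<^sub>M lborel)"
    and ftc: "\<And>z \<theta>. \<lbrakk>\<theta> \<in> {u<..<v}; z \<in> {l..r}\<rbrakk> \<Longrightarrow> ((\<lambda>t. D t \<theta>) has_integral \<beta> z \<theta> - \<beta> l \<theta>) {l..z}"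
    and int: "\<And>t. t \<in> {l..r} \<Longrightarrow> set_integrable lborel {u<..<v} (D t)"
    and bound: "\<And>t. t \<in> {l..r} \<Longrightarrow> (LINT \<theta>:{u<..<v}|lborel. \<bar>D t \<theta>\<bar>) \<le> C"
    and cont: "continuous_on {l..r} (\<lambda>t. LINT \<theta>:{u<..<v}|lborel. D t \<theta>)"
    and int\<beta>: "\<And>t. t \<in> {l..r} \<Longrightarrow> set_integrable lborel {u<..<v} (\<beta> t)"
  shows "((\<lambda>t. LINT \<theta>:{u<..<v}|lborel. \<beta> t \<theta>) has_real_derivative (LINT \<theta>:{u<..<v}|lborel. D x \<theta>)) (at x)"
proof -
  define I where "I t = (LINT \<theta>:{u<..<v}|lborel. D t \<theta>)" for t
  define F where "F t = (LINT \<theta>:{u<..<v}|lborel. \<beta> t \<theta>)" for t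
  \<comment> \<open>The increment of \<open>\<beta>\<close> is an integral over the parameter;
    exchanging the order of integration exhibits the increment of \<open>F\<close> as an integral of
    \<open>I\<close>, and continuity of \<open>I\<close> then gives the derivative.\<close>
  have F: "F z = F l + integral {l..z} I" if z: "z \<in> {l..r}" for z
  proof -
    define g where "g = (\<lambda>(t, \<theta>). indicator {l..z} t * (indicator {u<..<v} \<theta> * D t \<theta>))"
    have g: "g = (\<lambda>p. indicator ({l..z} \<times> {u<..<v}) p * (\<lambda>(t, \<theta>). D t \<theta>) p)"
      by (auto simp: g_def indicator_def fun_eq_iff)
    have [measurable]: "g \<in> borel_measurable (lborel \<Otimes>\<^sub>M lborel)"
      unfolding g by (intro borel_measurable_times meas borel_measurable_indicator) auto
    have gi: "integrable (lborel \<Otimes>\<^sub>M lborel) g"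
    proof (rule lborel_pair.Fubini_integrable)
      show "AE t in lborel. integrable lborel (\<lambda>\<theta>. g (t, \<theta>))"
      proof (rule AE_I2)
        fix t
        show "integrable lborel (\<lambda>\<theta>. g (t, \<theta>))"
          using int[of t] z by (cases "t \<in> {l..z}") (auto simp: g_def set_integrable_def)
      qed
      have "set_integrable lborel {l..z} (\<lambda>t. C)"
        by (intro borel_integrable_atLeastAtMost') auto
      then show "integrable lborel (\<lambda>t. LINT \<theta>|lborel. norm (g (t, \<theta>)))"
        unfolding set_integrable_def
      proof (rule Bochner_Integration.integrable_bound, goal_cases)
        case 2
        have "norm (LINT \<theta>|lborel. norm (g (t, \<theta>))) \<le> norm (indicat_real {l..z} t *\<^sub>R C)" for t
        proof (cases "t \<in> {l..z}")
          case True
          then have "(LINT \<theta>|lborel. norm (g (t, \<theta>))) = (LINT \<theta>:{u<..<v}|lborel. \<bar>D t \<theta>\<bar>)"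
            by (simp add: g_def set_lebesgue_integral_def abs_mult)
          also have "\<dots> \<le> C" using True z by (intro bound) auto
          finally show ?thesis using True by (simp add: abs_of_nonneg)
        qed (simp add: g_def)
        then show ?case by blast
      qed measurable
    qed simp
    have "F z - F l = (LINT \<theta>|lborel. indicator {u<..<v} \<theta> * (\<beta> z \<theta> - \<beta> l \<theta>))"
      using set_integral_diff(2)[OF int\<beta>[OF z] int\<beta>[of l]] x by (simp add: F_def set_lebesgue_integral_def)
    also have "\<dots> = (LINT \<theta>|lborel. LINT t|lborel. g (t, \<theta>))"
    proof (rule integral_cong_AE)
      have "AE \<theta> in lborel. integrable lborel (\<lambda>t. g (t, \<theta>))"
        using lborel_pair.AE_integrable_snd[of "\<lambda>t \<theta>. g (t, \<theta>)"] gi by simp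
      then show "AE \<theta> in lborel. indicator {u<..<v} \<theta> * (\<beta> z \<theta> - \<beta> l \<theta>) = (LINT t|lborel. g (t, \<theta>))"
      proof eventually_elim
        case (elim \<theta>)
        show ?case
        proof (cases "\<theta> \<in> {u<..<v}")
          case True
          then have "set_integrable lborel {l..z} (\<lambda>t. D t \<theta>)"
            using elim by (simp add: set_integrable_def g_def)
          from set_borel_integral_eq_integral(2)[OF this]
          have "(LINT t:{l..z}|lborel. D t \<theta>) = \<beta> z \<theta> - \<beta> l \<theta>"
            using integral_unique[OF ftc[OF True z]] by simp
          then show ?thesis using True by (simp add: g_def set_lebesgue_integral_def)
        qed (simp add: g_def)
      qed
      have "set_integrable lborel {u<..<v} (\<lambda>\<theta>. \<beta> z \<theta> - \<beta> l \<theta>)"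
        using x z by (intro set_integral_diff int\<beta>) auto
      then show "(\<lambda>\<theta>. indicator {u<..<v} \<theta> * (\<beta> z \<theta> - \<beta> l \<theta>)) \<in> borel_measurable lborel"
        by (simp add: set_integrable_def)
      show "(\<lambda>\<theta>. LINT t|lborel. g (t, \<theta>)) \<in> borel_measurable lborel"
        using lborel_pair.integrable_snd[of "\<lambda>t \<theta>. g (t, \<theta>)"] gi by simp
    qed
    also have "\<dots> = (LINT t|lborel. LINT \<theta>|lborel. g (t, \<theta>))"
      using lborel_pair.Fubini_integral[of "\<lambda>t \<theta>. g (t, \<theta>)"] gi by simp
    also have "\<dots> = (LINT t:{l..z}|lborel. I t)"
      by (simp add: g_def I_def set_lebesgue_integral_def)
    also have "\<dots> = integral {l..z} I"
    proof (rule set_borel_integral_eq_integral(2))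
      show "set_integrable lborel {l..z} I"
        using cont z unfolding I_def
        by (intro borel_integrable_atLeastAtMost' continuous_on_subset[OF cont]) auto
    qed
    finally show ?thesis by simp
  qed
  have "((\<lambda>z. F l + integral {l..z} I) has_real_derivative 0 + I x) (at x within {l..r})"
    using x cont by (intro DERIV_add DERIV_const integral_has_real_derivative) (auto simp: I_def[abs_def])
  then have "((\<lambda>z. F l + integral {l..z} I) has_real_derivative I x) (at x)"
    using x at_within_interior[of x "{l..r}"] by simp
  moreover have "\<forall>\<^sub>F z in nhds x. z \<in> {l<..<r}"
    using x by (intro eventually_nhds_in_open) auto
  then have "\<forall>\<^sub>F z in nhds x. F z = F l + integral {l..z} I"
    by eventually_elim (auto intro: F)
  ultimately have "(F has_real_derivative I x) (at x)"
    by (subst DERIV_cong_ev[OF refl _ refl])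
  then show ?thesis by (simp add: I_def F_def[abs_def])
qed

section \<open>Reduction to Legendre form\<close>

text \<open>
  \<open>legendre_map\<close> solves \<open>(A3 - A1) (R - A2) / ((A3 - A2) (R - A1)) = (sin t)\<^sup>2\<close> for \<open>R\<close>: the Moebius map on the
  left sends \<open>A2, A3, A1, A4\<close> to \<open>0, 1, \<infinity>, 1 / k\<^sup>2\<close>.
\<close>

definition legendre_map :: "real \<Rightarrow> real \<Rightarrow> real \<Rightarrow> real \<Rightarrow> real" where
  "legendre_map A1 A2 A3 t = A1 + (A2 - A1) / (1 - (A3 - A2) / (A3 - A1) * (sin t)\<^sup>2)"

definition legendre_k2 :: "real \<Rightarrow> real \<Rightarrow> real \<Rightarrow> real \<Rightarrow> real" where
  "legendre_k2 A1 A2 A3 A4 = (A4 - A1) * (A3 - A2) / ((A4 - A2) * (A3 - A1))"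

text \<open>Stands for the integral of \<open>w\<close> over the square root of the quartic between
  its middle roots. The substituted form is taken as the definition since its interval is fixed and
  its integrand has no endpoint singularities for continuous \<open>w\<close>.\<close>

definition legendre :: "real \<Rightarrow> real \<Rightarrow> real \<Rightarrow> real \<Rightarrow> (real \<Rightarrow> real) \<Rightarrow> real" where
  "legendre A1 A2 A3 A4 w = 2 / sqrt ((A4 - A2) * (A3 - A1)) *
     integral {0..pi / 2} (\<lambda>t. w (legendre_map A1 A2 A3 t) / sqrt (1 - legendre_k2 A1 A2 A3 A4 * (sin t)\<^sup>2))"

locale four_roots =
  fixes A1 A2 A3 A4 :: real
  assumes A12: "A1 < A2" and A23: "A2 < A3" and A34: "A3 < A4"
begin

definition "\<alpha> = (A3 - A2) / (A3 - A1)"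
definition "k2 = legendre_k2 A1 A2 A3 A4"
definition "\<rho> = legendre_map A1 A2 A3"

lemma \<alpha>: "0 < \<alpha>" "\<alpha> < 1"
  using A12 A23 by (auto simp: \<alpha>_def)

lemma k2: "0 < k2" "k2 < 1"
proof -
  show "0 < k2" using A12 A23 A34 by (auto simp: k2_def legendre_k2_def)
  have "(A4 - A2) * (A3 - A1) - (A4 - A1) * (A3 - A2) = (A4 - A3) * (A2 - A1)"
    by (simp add: algebra_simps)
  also have "\<dots> > 0" using A12 A34 by simp
  finally show "k2 < 1" using A12 A23 A34 by (simp add: k2_def legendre_k2_def)
qed

lemma sin_sq: "0 \<le> (sin t)\<^sup>2" "(sin t)\<^sup>2 \<le> (1::real)"
  using abs_sin_le_one[of t] by (auto simp: abs_square_le_1)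

lemma u_pos: "0 < 1 - \<alpha> * (sin t)\<^sup>2" and k2_pos: "0 < 1 - k2 * (sin t)\<^sup>2"
proof -
  have "\<alpha> * (sin t)\<^sup>2 \<le> \<alpha> * 1" "k2 * (sin t)\<^sup>2 \<le> k2 * 1"
    using sin_sq[of t] \<alpha> k2 by (auto intro: mult_left_mono)
  then show "0 < 1 - \<alpha> * (sin t)\<^sup>2" "0 < 1 - k2 * (sin t)\<^sup>2"
    using \<alpha> k2 by linarith+
qed

lemma \<rho>_eq: "\<rho> t = A1 + (A2 - A1) / (1 - \<alpha> * (sin t)\<^sup>2)"
  by (simp add: \<rho>_def legendre_map_def \<alpha>_def)

text \<open>All four factors of the quartic acquire the same denominator, and their numerators are
  constants times 1, sin^2, cos^2 and 1 - k2 sin^2. This makes the square root explicit.\<close>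

lemma diffs:
  "\<rho> t - A1 = (A2 - A1) / (1 - \<alpha> * (sin t)\<^sup>2)"
  "\<rho> t - A2 = (A2 - A1) * \<alpha> * (sin t)\<^sup>2 / (1 - \<alpha> * (sin t)\<^sup>2)"
  "A3 - \<rho> t = (A3 - A2) * (cos t)\<^sup>2 / (1 - \<alpha> * (sin t)\<^sup>2)"
  "A4 - \<rho> t = (A4 - A2) * (1 - k2 * (sin t)\<^sup>2) / (1 - \<alpha> * (sin t)\<^sup>2)"
proof -
  have u: "1 - \<alpha> * (sin t)\<^sup>2 \<noteq> 0" using u_pos[of t] by simp
  have a: "(A3 - A1) * \<alpha> = A3 - A2" and k: "(A4 - A2) * k2 = (A4 - A1) * \<alpha>"
    using A12 A23 A34 by (auto simp: \<alpha>_def k2_def legendre_k2_def)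
  show "\<rho> t - A1 = (A2 - A1) / (1 - \<alpha> * (sin t)\<^sup>2)" by (simp add: \<rho>_eq)
  show "\<rho> t - A2 = (A2 - A1) * \<alpha> * (sin t)\<^sup>2 / (1 - \<alpha> * (sin t)\<^sup>2)"
    using u by (simp add: \<rho>_eq field_simps)
  have "A3 - \<rho> t = ((A3 - A2) - (A3 - A1) * \<alpha> * (sin t)\<^sup>2) / (1 - \<alpha> * (sin t)\<^sup>2)"
    using u by (simp add: \<rho>_eq field_simps)
  also have "(A3 - A2) - (A3 - A1) * \<alpha> * (sin t)\<^sup>2 = (A3 - A2) * (cos t)\<^sup>2"
    by (simp add: a cos_squared_eq right_diff_distrib)
  finally show "A3 - \<rho> t = (A3 - A2) * (cos t)\<^sup>2 / (1 - \<alpha> * (sin t)\<^sup>2)" .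
  have "A4 - \<rho> t = ((A4 - A2) - (A4 - A1) * \<alpha> * (sin t)\<^sup>2) / (1 - \<alpha> * (sin t)\<^sup>2)"
    using u by (simp add: \<rho>_eq field_simps)
  also have "(A4 - A2) - (A4 - A1) * \<alpha> * (sin t)\<^sup>2 = (A4 - A2) * (1 - k2 * (sin t)\<^sup>2)"
    by (simp add: k[symmetric] right_diff_distrib)
  finally show "A4 - \<rho> t = (A4 - A2) * (1 - k2 * (sin t)\<^sup>2) / (1 - \<alpha> * (sin t)\<^sup>2)" .
qed

lemma \<rho>_bounds: "A2 \<le> \<rho> t" "\<rho> t \<le> A3"
proof -
  have "0 \<le> \<rho> t - A2" "0 \<le> A3 - \<rho> t"
    unfolding diffs using u_pos[of t] A12 A23 \<alpha> by auto
  then show "A2 \<le> \<rho> t" "\<rho> t \<le> A3" by auto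
qed

lemma \<rho>_image: "\<rho> ` {0<..<pi / 2} = {A2<..<A3}"
proof
  show "\<rho> ` {0<..<pi / 2} \<subseteq> {A2<..<A3}"
  proof safe
    fix t :: real assume t: "t \<in> {0<..<pi / 2}"
    then have "0 < sin t" "0 < cos t" by (auto intro: sin_gt_zero cos_gt_zero)
    then have "0 < \<rho> t - A2" "0 < A3 - \<rho> t"
      unfolding diffs using u_pos[of t] A12 A23 \<alpha> by auto
    then show "\<rho> t \<in> {A2<..<A3}" by auto
  qed
  show "{A2<..<A3} \<subseteq> \<rho> ` {0<..<pi / 2}"
  proof
    fix R assume R: "R \<in> {A2<..<A3}"
    \<comment> \<open>The Moebius image of \<open>R\<close>, which has to be the squared sine of the
      preimage.\<close>
    define s where "s = (R - A2) / (\<alpha> * (R - A1))"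
    have "(A3 - A2) * (R - A1) - (R - A2) * (A3 - A1) = (A3 - R) * (A2 - A1)"
      by (simp add: algebra_simps)
    also have "\<dots> > 0" using R A12 by simp
    finally have "(R - A2) * (A3 - A1) < (A3 - A2) * (R - A1)" by simp
    moreover have "s = (R - A2) * (A3 - A1) / ((A3 - A2) * (R - A1))"
      by (simp add: s_def \<alpha>_def)
    ultimately have s: "0 < s" "s < 1"
      using R A12 A23 by simp_all
    define t where "t = arcsin (sqrt s)"
    have "sin t = sqrt s" unfolding t_def using s by (intro sin_arcsin) (auto intro: order_trans[of _ 0])
    then have st: "(sin t)\<^sup>2 = s" using s by simp
    have "arcsin 0 < t" "t < arcsin 1"
      unfolding t_def using s by (intro arcsin_less_mono[THEN iffD2]; auto)+
    moreover have "\<rho> t = R"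
    proof -
      have "1 - \<alpha> * s = (A2 - A1) / (R - A1)"
        using R A12 \<alpha> by (simp add: s_def field_simps)
      then show ?thesis using R A12 by (simp add: \<rho>_eq st)
    qed
    ultimately show "R \<in> \<rho> ` {0<..<pi / 2}" by (intro image_eqI[of _ _ t]) auto
  qed
qed

lemma \<rho>_inj: "inj_on \<rho> {0<..<pi / 2}"
proof (rule inj_onI)
  fix s t assume st: "s \<in> {0<..<pi / 2}" "t \<in> {0<..<pi / 2}" and "\<rho> s = \<rho> t"
  then have "(A2 - A1) / (1 - \<alpha> * (sin s)\<^sup>2) = (A2 - A1) / (1 - \<alpha> * (sin t)\<^sup>2)"
    by (simp add: \<rho>_eq)
  then have "(sin s)\<^sup>2 = (sin t)\<^sup>2"
    using u_pos[of s] u_pos[of t] A12 \<alpha> by (simp add: frac_eq_eq)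
  moreover have "0 \<le> sin s" "0 \<le> sin t" using st by (auto intro: sin_ge_zero)
  ultimately have "sin s = sin t" by (rule power2_eq_imp_eq)
  then show "s = t" using st sin_inj_pi[of s t] by auto
qed

lemma \<rho>_deriv:
  "(\<rho> has_field_derivative (A2 - A1) * \<alpha> * 2 * sin t * cos t / (1 - \<alpha> * (sin t)\<^sup>2)\<^sup>2) (at t within S)"
  unfolding \<rho>_eq[abs_def]
  using u_pos[of t]
  by (auto intro!: derivative_eq_intros simp: power2_eq_square)

abbreviation "quartic R \<equiv> (R - A1) * (R - A2) * (A3 - R) * (A4 - R)"

lemma pulled_back_weight:
  assumes t: "t \<in> {0<..<pi / 2}"
  shows "\<bar>(A2 - A1) * \<alpha> * 2 * sin t * cos t / (1 - \<alpha> * (sin t)\<^sup>2)\<^sup>2\<bar> / sqrt (quartic (\<rho> t))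
     = 2 / sqrt ((A4 - A2) * (A3 - A1)) / sqrt (1 - k2 * (sin t)\<^sup>2)"
proof -
  let ?u = "1 - \<alpha> * (sin t)\<^sup>2" and ?v = "1 - k2 * (sin t)\<^sup>2"
  have sc: "0 < sin t" "0 < cos t" using t by (auto intro: sin_gt_zero cos_gt_zero)
  have u: "0 < ?u" and v: "0 < ?v" by (rule u_pos k2_pos)+
  have d: "0 < A2 - A1" "0 < A4 - A2" "0 < A3 - A1" "0 < A3 - A2" using A12 A23 A34 by auto
  \<comment> \<open>The squared factor is half the derivative of \<open>\<rho>\<close>, so the
    Jacobian cancels against it and leaves the factor 2.\<close>
  have q: "quartic (\<rho> t) = ((A2 - A1) * \<alpha> * sin t * cos t / ?u\<^sup>2)\<^sup>2 * ((A4 - A2) * (A3 - A1) * ?v)"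
  proof -
    have a: "A3 - A2 = \<alpha> * (A3 - A1)" using d by (simp add: \<alpha>_def)
    show ?thesis unfolding diffs a using u by (simp add: field_simps power2_eq_square)
  qed
  define X where "X = (A2 - A1) * \<alpha> * sin t * cos t / ?u\<^sup>2"
  have X: "X > 0"
    using d \<alpha> sc u by (simp add: X_def)
  have "sqrt (quartic (\<rho> t)) = X * (sqrt ((A4 - A2) * (A3 - A1)) * sqrt ?v)"
    using q X unfolding X_def[symmetric] by (simp only: real_sqrt_mult real_sqrt_abs abs_of_pos)
  moreover have "\<bar>(A2 - A1) * \<alpha> * 2 * sin t * cos t / ?u\<^sup>2\<bar> = 2 * X"
  proof -
    have "(A2 - A1) * \<alpha> * 2 * sin t * cos t / ?u\<^sup>2 = 2 * X" by (simp add: X_def)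
    then show ?thesis using X by simp
  qed
  ultimately show ?thesis using X by simp
qed

text \<open>The change of variables is made on open intervals, where \<open>\<rho>\<close> is
  injective and the quartic positive. The substituted integrand extends continuously to [0, pi / 2],
  which yields integrability.\<close>

lemma legendre_integral:
  assumes w: "continuous_on {A2..A3} w"
  shows "(\<lambda>R. w R / sqrt (quartic R)) absolutely_integrable_on {A2<..<A3}"
    and "integral {A2<..<A3} (\<lambda>R. w R / sqrt (quartic R)) = legendre A1 A2 A3 A4 w"
proof -
  let ?g' = "\<lambda>t. (A2 - A1) * \<alpha> * 2 * sin t * cos t / (1 - \<alpha> * (sin t)\<^sup>2)\<^sup>2"
  let ?f = "\<lambda>R. w R / sqrt (quartic R)"
  let ?G = "\<lambda>t. 2 / sqrt ((A4 - A2) * (A3 - A1)) * (w (\<rho> t) / sqrt (1 - k2 * (sin t)\<^sup>2))"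
  have eq: "\<bar>?g' t\<bar> * ?f (\<rho> t) = ?G t" if "t \<in> {0<..<pi / 2}" for t
  proof -
    have "\<bar>?g' t\<bar> * ?f (\<rho> t) = w (\<rho> t) * (\<bar>?g' t\<bar> / sqrt (quartic (\<rho> t)))" by simp
    then show ?thesis unfolding pulled_back_weight[OF that] by simp
  qed
  have "continuous_on UNIV \<rho>"
    unfolding \<rho>_eq[abs_def] using u_pos by (intro continuous_intros) (auto simp: less_imp_neq[symmetric])
  then have "continuous_on {0..pi / 2} ?G"
    using \<rho>_bounds k2_pos A12 A23 A34
    by (intro continuous_intros continuous_on_compose2[OF w])
       (auto intro: continuous_on_subset simp: less_imp_neq[symmetric])
  then have "?G absolutely_integrable_on {0..pi / 2}"
    by (rule absolutely_integrable_continuous_real)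
  then have G: "?G absolutely_integrable_on {0<..<pi / 2}"
    by (rule set_integrable_subset) auto
  have "integral {0<..<pi / 2} ?G = integral {0..pi / 2} ?G"
    by (rule integral_open_interval_real[symmetric])
  also have "\<dots> = legendre A1 A2 A3 A4 w"
    unfolding legendre_def k2_def \<rho>_def by (rule integral_mult_right)
  finally have GI: "integral {0<..<pi / 2} ?G = legendre A1 A2 A3 A4 w" .
  have "(\<lambda>t. \<bar>?g' t\<bar> * ?f (\<rho> t)) absolutely_integrable_on {0<..<pi / 2} \<and>
      integral {0<..<pi / 2} (\<lambda>t. \<bar>?g' t\<bar> * ?f (\<rho> t)) = legendre A1 A2 A3 A4 w"
  proof
    show "(\<lambda>t. \<bar>?g' t\<bar> * ?f (\<rho> t)) absolutely_integrable_on {0<..<pi / 2}"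
      by (rule iffD2[OF set_integrable_cong[OF refl refl eq] G])
    show "integral {0<..<pi / 2} (\<lambda>t. \<bar>?g' t\<bar> * ?f (\<rho> t)) = legendre A1 A2 A3 A4 w"
      unfolding GI[symmetric] by (rule integral_cong) (rule eq)
  qed
  then have "?f absolutely_integrable_on (\<rho> ` {0<..<pi / 2}) \<and>
      integral (\<rho> ` {0<..<pi / 2}) ?f = legendre A1 A2 A3 A4 w"
    by (subst (asm) has_absolute_integral_change_of_variables_1')
       (auto intro: \<rho>_deriv \<rho>_inj)
  then show "?f absolutely_integrable_on {A2<..<A3}" "integral {A2<..<A3} ?f = legendre A1 A2 A3 A4 w"
    by (auto simp: \<rho>_image)
qed

end

section \<open>The four branch points\<close>

text \<open>After the substitution the parameter moves neither the interval nor any singularity, so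
  continuity under the integral sign applies. The weight has to be continuous only between the
  middle roots.\<close>

lemma continuous_on_legendre:
  fixes A1 A2 A3 A4 :: "'z :: t2_space \<Rightarrow> real"
  assumes A: "continuous_on U A1" "continuous_on U A2" "continuous_on U A3" "continuous_on U A4"
    and roots: "\<And>z. z \<in> U \<Longrightarrow> four_roots (A1 z) (A2 z) (A3 z) (A4 z)"
    and w: "continuous_on (SIGMA z:U. {A2 z..A3 z}) (\<lambda>(z, R). w z R)"
  shows "continuous_on U (\<lambda>z. legendre (A1 z) (A2 z) (A3 z) (A4 z) (w z))"
proof -
  have ne: "A3 z - A1 z \<noteq> 0" "A4 z - A2 z \<noteq> 0"  if "z \<in> U" for z
    using four_roots.A12[OF roots[OF that]] four_roots.A23[OF roots[OF that]] four_roots.A34[OF roots[OF that]]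
    by auto
  have u: "1 - (A3 z - A2 z) / (A3 z - A1 z) * (sin t)\<^sup>2 \<noteq> 0" if "z \<in> U" for z t
    using four_roots.u_pos[OF roots[OF that], of t] unfolding four_roots.\<alpha>_def[OF roots[OF that]]
    by (metis less_irrefl)
  have k: "sqrt (1 - legendre_k2 (A1 z) (A2 z) (A3 z) (A4 z) * (sin t)\<^sup>2) \<noteq> 0" if "z \<in> U" for z t
    using four_roots.k2_pos[OF roots[OF that], of t] by (simp add: four_roots.k2_def[OF roots[OF that]])
  have b: "legendre_map (A1 z) (A2 z) (A3 z) t \<in> {A2 z..A3 z}" if "z \<in> U" for z t
    using four_roots.\<rho>_bounds[OF roots[OF that], of t] by (simp add: four_roots.\<rho>_def[OF roots[OF that]])
  define V where "V = U \<times> cbox 0 (pi / 2 :: real)"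
  have A': "continuous_on V (\<lambda>p. A1 (fst p))" "continuous_on V (\<lambda>p. A2 (fst p))"
     "continuous_on V (\<lambda>p. A3 (fst p))" "continuous_on V (\<lambda>p. A4 (fst p))"
    unfolding V_def by (auto intro!: continuous_on_compose2[OF A(1)] continuous_on_compose2[OF A(2)]
       continuous_on_compose2[OF A(3)] continuous_on_compose2[OF A(4)] continuous_intros)
  have "continuous_on V (\<lambda>p. legendre_map (A1 (fst p)) (A2 (fst p)) (A3 (fst p)) (snd p))"
    unfolding legendre_map_def using ne u
    by (intro continuous_intros A') (auto simp: V_def)
  then have "continuous_on V (\<lambda>p. (fst p, legendre_map (A1 (fst p)) (A2 (fst p)) (A3 (fst p)) (snd p)))"
    by (intro continuous_intros)
  from continuous_on_compose2[OF w this]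
  have W: "continuous_on V (\<lambda>p. w (fst p) (legendre_map (A1 (fst p)) (A2 (fst p)) (A3 (fst p)) (snd p)))"
    using b by (force simp: V_def)
  have "continuous_on V (\<lambda>p. 1 - legendre_k2 (A1 (fst p)) (A2 (fst p)) (A3 (fst p)) (A4 (fst p)) * (sin (snd p))\<^sup>2)"
    unfolding legendre_k2_def using ne by (intro continuous_intros A') (auto simp: V_def)
  then have "continuous_on V (\<lambda>p. w (fst p) (legendre_map (A1 (fst p)) (A2 (fst p)) (A3 (fst p)) (snd p)) /
       sqrt (1 - legendre_k2 (A1 (fst p)) (A2 (fst p)) (A3 (fst p)) (A4 (fst p)) * (sin (snd p))\<^sup>2))"
    using k by (intro continuous_on_divide W continuous_on_real_sqrt) (auto simp: V_def)
  then have "continuous_on U (\<lambda>z. integral (cbox 0 (pi / 2)) (\<lambda>t. w z (legendre_map (A1 z) (A2 z) (A3 z) t) /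
       sqrt (1 - legendre_k2 (A1 z) (A2 z) (A3 z) (A4 z) * (sin t)\<^sup>2)))"
    unfolding V_def by (intro integral_continuous_on_param) (simp add: case_prod_beta)
  then show ?thesis
    unfolding legendre_def box_real[symmetric] using ne
    by (intro continuous_on_mult continuous_intros A) auto
qed

text \<open>
  Up to the factor 16, Heron's formula for the squared area of the triangle with sides \<open>r\<close>, \<open>s\<close>, \<open>sqrt R\<close>.
\<close>

definition heron :: "real \<Rightarrow> real \<Rightarrow> real \<Rightarrow> real" where
  "heron r s R = (R - (r - s)\<^sup>2) * ((r + s)\<^sup>2 - R)"

text \<open>The ends of the range of \<open>side2 Q\<close> and of the range where the triangle
  exists, sorted without reference to chambers: the second and third root bound the intersection
  when it is nonempty.\<close>

definition "root1 Q r s = min ((1 - Q)\<^sup>2) ((r - s)\<^sup>2 :: real)"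
definition "root2 Q r s = max ((1 - Q)\<^sup>2) ((r - s)\<^sup>2 :: real)"
definition "root3 Q r s = min ((1 + Q)\<^sup>2) ((r + s)\<^sup>2 :: real)"
definition "root4 Q r s = max ((1 + Q)\<^sup>2) ((r + s)\<^sup>2 :: real)"
lemmas root_defs = root1_def root2_def root3_def root4_def

text \<open>The form in which the analysis uses that a point lies in the amoeba and off the
  contour.\<close>

definition generic :: "real \<Rightarrow> real \<Rightarrow> real \<Rightarrow> bool" where
  "generic Q r s \<longleftrightarrow> 0 < Q \<and> 0 < r \<and> 0 < s \<and>
     four_roots (root1 Q r s) (root2 Q r s) (root3 Q r s) (root4 Q r s)"

definition ell :: "real \<Rightarrow> real \<Rightarrow> real \<Rightarrow> (real \<Rightarrow> real) \<Rightarrow> real" where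
  "ell Q r s = legendre (root1 Q r s) (root2 Q r s) (root3 Q r s) (root4 Q r s)"

lemma quartic_roots:
  "(R - root1 Q r s) * (R - root2 Q r s) * (root3 Q r s - R) * (root4 Q r s - R)
    = (R - (1 - Q)\<^sup>2) * ((1 + Q)\<^sup>2 - R) * heron r s R"
  by (simp add: root_defs heron_def min_def max_def)

lemma side2_has_derivative [derivative_intros]:
  "((\<lambda>t. side2 Q t) has_field_derivative - 2 * Q * sin t) (at t within S)"
  unfolding side2_def by (auto intro!: derivative_eq_intros)

text \<open>Hence the Jacobian of \<open>side2\<close> is the square root of the two quartic factors
  that \<open>heron\<close> lacks.\<close>

lemma sin_side2: "(2 * Q * sin t)\<^sup>2 = (side2 Q t - (1 - Q)\<^sup>2) * ((1 + Q)\<^sup>2 - side2 Q t)"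
proof -
  have "(side2 Q t - (1 - Q)\<^sup>2) * ((1 + Q)\<^sup>2 - side2 Q t) = 4 * Q\<^sup>2 * (1 - (cos t)\<^sup>2)"
    by (simp add: side2_def power2_eq_square algebra_simps)
  then show ?thesis by (simp add: power_mult_distrib sin_squared_eq)
qed

lemma side2_bounds:
  assumes "Q > 0" "t \<in> {0<..<pi}"
  shows "(1 - Q)\<^sup>2 < side2 Q t" "side2 Q t < (1 + Q)\<^sup>2"
proof -
  have "cos t < 1" "-1 < cos t"
    using assms cos_monotone_0_pi[of 0 t] cos_monotone_0_pi[of t pi] by auto
  then have "0 < 2 * (Q * (1 + cos t))" "0 < 2 * (Q * (1 - cos t))"
    using assms by simp_all
  moreover have "2 * (Q * (1 + cos t)) = side2 Q t - (1 - Q)\<^sup>2"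
    by (simp add: side2_def power2_eq_square algebra_simps)
  moreover have "2 * (Q * (1 - cos t)) = (1 + Q)\<^sup>2 - side2 Q t"
    by (simp add: side2_def power2_eq_square algebra_simps)
  ultimately show "(1 - Q)\<^sup>2 < side2 Q t" "side2 Q t < (1 + Q)\<^sup>2"
    by simp_all
qed

lemma heron_pos_iff:
  assumes "r > 0" "s > 0"
  shows "heron r s R > 0 \<longleftrightarrow> (r - s)\<^sup>2 < R \<and> R < (r + s)\<^sup>2"
proof -
  have "(r - s)\<^sup>2 < (r + s)\<^sup>2" using assms by (simp add: power2_eq_square algebra_simps)
  then show ?thesis by (auto simp: heron_def zero_less_mult_iff)
qed

text \<open>With \<open>side2 Q t\<close> as the new variable, the region where \<open>heron\<close>
  is positive becomes the interval between the middle roots, and the Jacobian completes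
  \<open>heron\<close> to the quartic.\<close>

lemma angle_integral:
  assumes gen: "generic Q r s" and w: "continuous_on {root2 Q r s..root3 Q r s} w"
  defines "g \<equiv> (\<lambda>t. if heron r s (side2 Q t) > 0 then w (side2 Q t) / sqrt (heron r s (side2 Q t)) else 0)"
  shows "g absolutely_integrable_on {0<..<pi}" and "integral {0<..<pi} g = ell Q r s w"
proof -
  have pos: "Q > 0" "r > 0" "s > 0" and four: "four_roots (root1 Q r s) (root2 Q r s) (root3 Q r s) (root4 Q r s)"
    using gen by (auto simp: generic_def)
  define f where "f R = w R / sqrt ((R - root1 Q r s) * (R - root2 Q r s) * (root3 Q r s - R) * (root4 Q r s - R))" for R
  define S where "S = {t \<in> {0<..<pi}. (r - s)\<^sup>2 < side2 Q t \<and> side2 Q t < (r + s)\<^sup>2}"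
  have "S = {0<..<pi} \<inter> {t. (r - s)\<^sup>2 < side2 Q t} \<inter> {t. side2 Q t < (r + s)\<^sup>2}"
    by (auto simp: S_def)
  moreover have "open \<dots>"
    by (intro open_Int open_Collect_less continuous_intros open_greaterThanLessThan)
  ultimately have Sm: "S \<in> sets lebesgue" by simp
  have inj: "inj_on (side2 Q) S"
    using pos cos_inj_pi by (auto intro!: inj_onI simp: S_def side2_def)
  have image: "side2 Q ` S = {root2 Q r s<..<root3 Q r s}"
  proof
    show "side2 Q ` S \<subseteq> {root2 Q r s<..<root3 Q r s}"
      using side2_bounds[OF pos(1)] by (auto simp: S_def root_defs)
    show "{root2 Q r s<..<root3 Q r s} \<subseteq> side2 Q ` S"
    proof
      fix R assume R: "R \<in> {root2 Q r s<..<root3 Q r s}"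
      define v where "v = (R - 1 - Q\<^sup>2) / (2 * Q)"
      have "-1 < v" "v < 1"
        using R pos by (auto simp: v_def root_defs field_simps power2_eq_square)
      then have "arccos v \<in> {0<..<pi}" "cos (arccos v) = v"
        using arccos_lt_bounded[of v] by auto
      moreover from this have "side2 Q (arccos v) = R"
        using pos by (simp add: side2_def v_def)
      ultimately show "R \<in> side2 Q ` S"
        using R by (intro image_eqI[of _ _ "arccos v"]) (auto simp: S_def root_defs)
    qed
  qed
  have eq: "\<bar>- 2 * Q * sin t\<bar> * f (side2 Q t) = w (side2 Q t) / sqrt (heron r s (side2 Q t))" if "t \<in> S" for t
  proof -
    have "0 < sin t" using that by (auto simp: S_def sin_gt_zero)
    then have "0 < 2 * Q * sin t" using pos by simp
    then show ?thesis
      unfolding f_def quartic_roots sin_side2[symmetric] real_sqrt_mult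
      using \<open>0 < sin t\<close> pos by simp
  qed
  have L: "f absolutely_integrable_on (side2 Q ` S) \<and> integral (side2 Q ` S) f = ell Q r s w"
    unfolding image ell_def f_def[abs_def]
    using four_roots.legendre_integral[OF four w] by blast
  have "(\<lambda>t. \<bar>- 2 * Q * sin t\<bar> * f (side2 Q t)) absolutely_integrable_on S \<and>
     integral S (\<lambda>t. \<bar>- 2 * Q * sin t\<bar> * f (side2 Q t)) = ell Q r s w"
    using has_absolute_integral_change_of_variables_1'[OF Sm side2_has_derivative inj, of f "ell Q r s w"] L by blast
  moreover have "\<bar>- 2 * Q * sin t\<bar> * f (side2 Q t) = g t" if "t \<in> S" for t
    using eq[OF that] that pos by (simp add: g_def heron_pos_iff S_def)
  ultimately have gS: "g absolutely_integrable_on S" "integral S g = ell Q r s w"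
    using set_integrable_cong[OF refl refl, of S "\<lambda>t. \<bar>- 2 * Q * sin t\<bar> * f (side2 Q t)" g lebesgue]
      integral_cong[of S "\<lambda>t. \<bar>- 2 * Q * sin t\<bar> * f (side2 Q t)" g] by simp_all
  have ind: "indicator {0<..<pi} t *\<^sub>R g t = indicator S t *\<^sub>R g t" for t
    using pos by (auto simp: indicator_def g_def S_def heron_pos_iff)
  show "g absolutely_integrable_on {0<..<pi}"
    using gS(1) unfolding set_integrable_def ind .
  have "integral S g = integral {0<..<pi} (\<lambda>t. if t \<in> S then g t else 0)"
    unfolding integral_restrict_Int by (rule arg_cong[of _ _ "\<lambda>S. integral S g"]) (auto simp: S_def)
  also have "\<dots> = integral {0<..<pi} g"
    using pos by (intro integral_cong) (auto simp: g_def S_def heron_pos_iff)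
  finally show "integral {0<..<pi} g = ell Q r s w"
    using gS(2) by simp
qed

lemma continuous_on_ell:
  fixes Q r s :: "'z :: t2_space \<Rightarrow> real"
  assumes "continuous_on U Q" "continuous_on U r" "continuous_on U s"
    and "\<And>z. z \<in> U \<Longrightarrow> generic (Q z) (r z) (s z)"
    and "continuous_on (SIGMA z:U. {root2 (Q z) (r z) (s z)..root3 (Q z) (r z) (s z)}) (\<lambda>(z, R). w z R)"
  shows "continuous_on U (\<lambda>z. ell (Q z) (r z) (s z) (w z))"
  unfolding ell_def
  by (rule continuous_on_legendre)
     (use assms in \<open>auto simp: generic_def root_defs intro!: continuous_intros\<close>)

section \<open>Derivatives of the mean angle\<close>

lemma set_integrable_lborel_of_absolutely_integrable:
  fixes f :: "real \<Rightarrow> real"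
  assumes "f absolutely_integrable_on S" "S \<in> sets borel" "f \<in> borel_measurable borel"
  shows "set_integrable lborel S f"
  using assms unfolding set_integrable_def by (subst (asm) integrable_completion) auto

text \<open>The squared sine of the angle, from area = s sqrt R sin / 2 and Heron's formula.\<close>

lemma cosine_heron:
  assumes "R > 0" "s > 0"
  shows "1 - (cosine r s R)\<^sup>2 = heron r s R / (2 * s * sqrt R)\<^sup>2"
proof -
  have "(2 * s * sqrt R)\<^sup>2 = 4 * s\<^sup>2 * R" using assms by (simp add: power_mult_distrib)
  moreover have "heron r s R = 4 * s\<^sup>2 * R - (R + s\<^sup>2 - r\<^sup>2)\<^sup>2"
    by (simp add: heron_def power2_eq_square algebra_simps)
  ultimately show ?thesis
    using assms unfolding cosine_def power_divide by (simp add: field_simps)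
qed

lemma abs_cosine_less_1_iff:
  assumes "R > 0" "s > 0"
  shows "\<bar>cosine r s R\<bar> < 1 \<longleftrightarrow> heron r s R > 0" "\<bar>cosine r s R\<bar> = 1 \<longleftrightarrow> heron r s R = 0"
proof -
  have p: "(2 * s * sqrt R)\<^sup>2 > 0" using assms by simp
  have "\<bar>cosine r s R\<bar> < 1 \<longleftrightarrow> 1 - (cosine r s R)\<^sup>2 > 0" by (simp add: abs_square_less_1)
  then show "\<bar>cosine r s R\<bar> < 1 \<longleftrightarrow> heron r s R > 0"
    unfolding cosine_heron[OF assms] using p by (simp add: zero_less_divide_iff)
  have "\<bar>cosine r s R\<bar> = 1 \<longleftrightarrow> 1 - (cosine r s R)\<^sup>2 = 0" by (simp add: abs_square_eq_1 abs_eq_iff power2_eq_1_iff)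
  then show "\<bar>cosine r s R\<bar> = 1 \<longleftrightarrow> heron r s R = 0"
    unfolding cosine_heron[OF assms] using p assms by simp
qed

lemma side2_pos: "Q > 0 \<Longrightarrow> t \<in> {0<..<pi} \<Longrightarrow> side2 Q t > 0"
  using side2_bounds(1)[of Q t] zero_le_power2[of "1 - Q"] by linarith

lemma mean_angle_lborel: "mean_angle Q r s = (LINT t:{0<..<pi}|lborel. arccos (clamp1 (cosine r s (side2 Q t))))"
  and set_integrable_angle_open: "set_integrable lborel {0<..<pi} (\<lambda>t. arccos (clamp1 (cosine r s (side2 Q t))))"
proof -
  show 1: "set_integrable lborel {0<..<pi} (\<lambda>t. arccos (clamp1 (cosine r s (side2 Q t))))"
    by (rule set_integrable_subset[OF set_integrable_angle[of 0 pi]]) auto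
  show "mean_angle Q r s = (LINT t:{0<..<pi}|lborel. arccos (clamp1 (cosine r s (side2 Q t))))"
    unfolding set_borel_integral_eq_integral(2)[OF 1] mean_angle_def
    by (rule integral_open_interval_real)
qed

text \<open>Common frame for moving a side and moving the modulus. Since sqrt (1 - cosine^2) is sqrt
  heron / (2 s sqrt R), the derivative of the angle is \<open>w\<close> over sqrt heron once
  \<open>w\<close> has absorbed the factor 2 s sqrt R; it must then depend on the angle through
  \<open>R\<close> alone.\<close>

lemma mean_angle_has_derivative:
  fixes Q r :: "real \<Rightarrow> real" and w :: "real \<Rightarrow> real \<Rightarrow> real" and h' :: "real \<Rightarrow> real \<Rightarrow> real"
  assumes x: "x \<in> {a<..<b}"
    and gen: "\<And>t. t \<in> {a..b} \<Longrightarrow> generic (Q t) (r t) s"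
    and contQ: "continuous_on UNIV Q" and contr: "continuous_on UNIV r"
    and contw: "continuous_on (SIGMA t:{a..b}. {root2 (Q t) (r t) s..root3 (Q t) (r t) s}) (\<lambda>(t, R). w t R)"
    and measw: "(\<lambda>p. w (fst p) (snd p)) \<in> borel_measurable (borel \<Otimes>\<^sub>M borel)"
    and fin: "\<And>\<theta>. \<theta> \<in> {0<..<pi} \<Longrightarrow> finite {t. heron (r t) s (side2 (Q t) \<theta>) = 0}"
    and der: "\<And>\<theta> t. \<lbrakk>\<theta> \<in> {0<..<pi}; t \<in> {a..b}\<rbrakk> \<Longrightarrow>
      ((\<lambda>t. cosine (r t) s (side2 (Q t) \<theta>)) has_real_derivative h' \<theta> t) (at t)"
    and w: "\<And>\<theta> t. \<lbrakk>\<theta> \<in> {0<..<pi}; t \<in> {a..b}\<rbrakk> \<Longrightarrow>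
      - h' \<theta> t * (2 * s * sqrt (side2 (Q t) \<theta>)) = w t (side2 (Q t) \<theta>)"
  shows "((\<lambda>t. mean_angle (Q t) (r t) s) has_real_derivative ell (Q x) (r x) s (w x)) (at x)"
proof -
  define D where "D t \<theta> = (if heron (r t) s (side2 (Q t) \<theta>) > 0
     then w t (side2 (Q t) \<theta>) / sqrt (heron (r t) s (side2 (Q t) \<theta>)) else 0)" for t \<theta>
  have pos: "Q t > 0" "r t > 0" "s > 0" if "t \<in> {a..b}" for t
    using gen[OF that] by (auto simp: generic_def)
  have [measurable]: "Q \<in> borel_measurable borel" "r \<in> borel_measurable borel"
    using contQ contr by (auto intro: borel_measurable_continuous_onI)
  have measS: "(\<lambda>p. side2 (Q (fst p)) (snd p)) \<in> borel_measurable (borel \<Otimes>\<^sub>M borel)"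
    unfolding side2_def by measurable
  have measH: "(\<lambda>p. heron (r (fst p)) s (side2 (Q (fst p)) (snd p))) \<in> borel_measurable (borel \<Otimes>\<^sub>M borel)"
    unfolding heron_def using measS by measurable
  have measW: "(\<lambda>p. w (fst p) (side2 (Q (fst p)) (snd p))) \<in> borel_measurable (borel \<Otimes>\<^sub>M borel)"
    using measurable_compose[OF measurable_Pair[OF measurable_fst measS] measw] by simp
  have meas: "(\<lambda>p. D (fst p) (snd p)) \<in> borel_measurable (borel \<Otimes>\<^sub>M borel)"
    unfolding D_def using measH measW by measurable
  have measD: "D t \<in> borel_measurable borel" for t
    using measurable_compose[OF _ meas, of "\<lambda>\<theta>. (t, \<theta>)" borel] by simp
  have contw_t: "continuous_on {root2 (Q t) (r t) s..root3 (Q t) (r t) s} (w t)" if "t \<in> {a..b}" for t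
    using continuous_on_compose2[OF contw, of _ "\<lambda>R. (t, R)"] that by (force intro!: continuous_intros)
  have absD: "\<bar>D t \<theta>\<bar> = (if heron (r t) s (side2 (Q t) \<theta>) > 0
     then \<bar>w t (side2 (Q t) \<theta>)\<bar> / sqrt (heron (r t) s (side2 (Q t) \<theta>)) else 0)" for t \<theta>
    by (simp add: D_def)
  have int: "set_integrable lborel {0<..<pi} (D t)" if "t \<in> {a..b}" for t
    using angle_integral(1)[OF gen contw_t, OF that that] measD
    by (intro set_integrable_lborel_of_absolutely_integrable) (auto simp: D_def[abs_def])
  have I: "(LINT \<theta>:{0<..<pi}|lborel. D t \<theta>) = ell (Q t) (r t) s (w t)" if "t \<in> {a..b}" for t
    unfolding set_borel_integral_eq_integral(2)[OF int[OF that]]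
    using angle_integral(2)[OF gen contw_t, OF that that] by (simp add: D_def[abs_def])
  \<comment> \<open>The weight |w| is again admissible, so the absolute integrals are continuous in
    \<open>t\<close> and bounded on the compact interval; this is the bound needed for Fubini's
    theorem.\<close>
  have Iabs: "(LINT \<theta>:{0<..<pi}|lborel. \<bar>D t \<theta>\<bar>) = ell (Q t) (r t) s (\<lambda>R. \<bar>w t R\<bar>)" if "t \<in> {a..b}" for t
    unfolding set_borel_integral_eq_integral(2)[OF set_integrable_abs[OF int[OF that]]]
    unfolding absD
    by (rule angle_integral(2)[OF gen[OF that] continuous_on_rabs[OF contw_t[OF that]]])
  have cont: "continuous_on {a..b} (\<lambda>t. ell (Q t) (r t) s (w t))"
    by (intro continuous_on_ell continuous_on_subset[OF contQ] continuous_on_subset[OF contr] gen contw) auto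
  have "continuous_on {a..b} (\<lambda>t. ell (Q t) (r t) s (\<lambda>R. \<bar>w t R\<bar>))"
    using continuous_on_rabs[OF contw]
    by (intro continuous_on_ell continuous_on_subset[OF contQ] continuous_on_subset[OF contr] gen)
      (auto simp: case_prod_beta)
  then have "compact ((\<lambda>t. ell (Q t) (r t) s (\<lambda>R. \<bar>w t R\<bar>)) ` {a..b})"
    by (intro compact_continuous_image) auto
  then have "bdd_above ((\<lambda>t. ell (Q t) (r t) s (\<lambda>R. \<bar>w t R\<bar>)) ` {a..b})"
    by (intro bounded_imp_bdd_above compact_imp_bounded)
  then obtain C where "\<forall>v \<in> (\<lambda>t. ell (Q t) (r t) s (\<lambda>R. \<bar>w t R\<bar>)) ` {a..b}. v \<le> C"
    unfolding bdd_above_def by blast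
  then have C: "ell (Q t) (r t) s (\<lambda>R. \<bar>w t R\<bar>) \<le> C" if "t \<in> {a..b}" for t
    using that by simp
  have ftc: "((\<lambda>t. D t \<theta>) has_integral arccos (clamp1 (cosine (r z) s (side2 (Q z) \<theta>)))
      - arccos (clamp1 (cosine (r a) s (side2 (Q a) \<theta>)))) {a..z}"
    if \<theta>: "\<theta> \<in> {0<..<pi}" and z: "z \<in> {a..b}" for z \<theta>
  proof -
    let ?h = "\<lambda>t. cosine (r t) s (side2 (Q t) \<theta>)"
    have S: "side2 (Q t) \<theta> > 0" if "t \<in> {a..z}" for t
      using that z pos \<theta> by (intro side2_pos) auto
    have s: "s > 0" using pos z by blast
    have fin': "finite {t \<in> {a..z}. \<bar>?h t\<bar> = 1}"
      by (rule finite_subset[OF _ fin[OF \<theta>]]) (use S s abs_cosine_less_1_iff(2) in auto)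
    have "((\<lambda>t. if \<bar>?h t\<bar> < 1 then - h' \<theta> t / sqrt (1 - (?h t)\<^sup>2) else 0) has_integral
      arccos (clamp1 (?h z)) - arccos (clamp1 (?h a))) {a..z}"
      using z \<theta> by (intro has_integral_arccos_clamp1[OF _ fin'] der) auto
    then show ?thesis
    proof (rule has_integral_eq[rotated])
      fix t assume t: "t \<in> {a..z}"
      have "- h' \<theta> t / sqrt (1 - (?h t)\<^sup>2) = D t \<theta>" if "heron (r t) s (side2 (Q t) \<theta>) > 0"
      proof -
        have "sqrt (1 - (?h t)\<^sup>2) = sqrt (heron (r t) s (side2 (Q t) \<theta>)) / (2 * s * sqrt (side2 (Q t) \<theta>))"
          unfolding cosine_heron[OF S[OF t] s] real_sqrt_divide real_sqrt_abs using s S[OF t] by simp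
        then have "- h' \<theta> t / sqrt (1 - (?h t)\<^sup>2)
            = - h' \<theta> t * (2 * s * sqrt (side2 (Q t) \<theta>)) / sqrt (heron (r t) s (side2 (Q t) \<theta>))"
          by simp
        also have "- h' \<theta> t * (2 * s * sqrt (side2 (Q t) \<theta>)) = w t (side2 (Q t) \<theta>)"
          using z t \<theta> by (intro w) auto
        finally show ?thesis using that by (simp add: D_def)
      qed
      then show "(if \<bar>?h t\<bar> < 1 then - h' \<theta> t / sqrt (1 - (?h t)\<^sup>2) else 0) = D t \<theta>"
        unfolding abs_cosine_less_1_iff(1)[OF S[OF t] s] by (simp add: D_def)
    qed
  qed
  have "((\<lambda>t. LINT \<theta>:{0<..<pi}|lborel. arccos (clamp1 (cosine (r t) s (side2 (Q t) \<theta>)))) has_real_derivative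
      (LINT \<theta>:{0<..<pi}|lborel. D x \<theta>)) (at x)"
  proof (rule has_derivative_integral_Fubini[OF x _ ftc int])
    show "(\<lambda>(t, \<theta>). D t \<theta>) \<in> borel_measurable (lborel \<Otimes>\<^sub>M lborel)"
      using meas by (simp add: case_prod_beta cong: measurable_cong_sets)
    show "(LINT \<theta>:{0<..<pi}|lborel. \<bar>D t \<theta>\<bar>) \<le> C" if "t \<in> {a..b}" for t
      using C Iabs that by simp
    show "continuous_on {a..b} (\<lambda>t. LINT \<theta>:{0<..<pi}|lborel. D t \<theta>)"
    proof -
      have "continuous_on {a..b} (\<lambda>t. LINT \<theta>:{0<..<pi}|lborel. D t \<theta>) \<longleftrightarrow>
          continuous_on {a..b} (\<lambda>t. ell (Q t) (r t) s (w t))"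
        by (intro continuous_on_cong refl I)
      then show ?thesis using cont by blast
    qed
  qed (auto intro: set_integrable_angle_open)
  then show ?thesis
    unfolding mean_angle_lborel using I[of x] x by simp
qed

text \<open>Differences of squares factor into linear forms. The lower ends differ iff the second
  and third chamber forms are nonzero, the upper ends iff the first is, and the intervals overlap
  iff the four strict quadrilateral inequalities hold.\<close>

lemma generic_iff:
  "generic Q r s \<longleftrightarrow> 0 < Q \<and> 0 < r \<and> 0 < s \<and>
     1 + Q - r - s \<noteq> 0 \<and> 1 + r - Q - s \<noteq> 0 \<and> 1 + s - Q - r \<noteq> 0 \<and>
     1 < Q + r + s \<and> Q < 1 + r + s \<and> r < 1 + Q + s \<and> s < 1 + Q + r"
proof (cases "0 < Q \<and> 0 < r \<and> 0 < s")
  case True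
  then have pos: "0 < Q" "0 < r" "0 < s" by auto
  have "(1 - Q)\<^sup>2 - (r - s)\<^sup>2 = (1 + r - Q - s) * (1 + s - Q - r)"
    by (simp add: power2_eq_square algebra_simps)
  then have 1: "root1 Q r s < root2 Q r s \<longleftrightarrow> 1 + r - Q - s \<noteq> 0 \<and> 1 + s - Q - r \<noteq> 0"
    unfolding root_defs by (smt (verit) mult_eq_0_iff)
  have "(1 + Q)\<^sup>2 - (r + s)\<^sup>2 = (1 + Q - r - s) * (1 + Q + r + s)"
    by (simp add: power2_eq_square algebra_simps)
  then have 2: "root3 Q r s < root4 Q r s \<longleftrightarrow> 1 + Q - r - s \<noteq> 0"
    unfolding root_defs using pos by (smt (verit) mult_eq_0_iff)
  have "(1 - Q)\<^sup>2 < (1 + Q)\<^sup>2" "(r - s)\<^sup>2 < (r + s)\<^sup>2"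
    using pos by (auto simp: power2_eq_square algebra_simps)
  moreover have "(1 - Q)\<^sup>2 < (r + s)\<^sup>2 \<longleftrightarrow> 1 < Q + r + s \<and> Q < 1 + r + s"
    unfolding not_le[symmetric] abs_le_square_iff[symmetric] using pos by (auto simp: abs_if)
  moreover have "(r - s)\<^sup>2 < (1 + Q)\<^sup>2 \<longleftrightarrow> r < 1 + Q + s \<and> s < 1 + Q + r"
    unfolding not_le[symmetric] abs_le_square_iff[symmetric] using pos by (auto simp: abs_if)
  ultimately have "root2 Q r s < root3 Q r s \<longleftrightarrow> 1 < Q + r + s \<and> Q < 1 + r + s \<and> r < 1 + Q + s \<and> s < 1 + Q + r"
    unfolding root_defs by auto
  then show ?thesis using 1 2 pos by (auto simp: generic_def four_roots_def)
qed (auto simp: generic_def)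

lemma open_generic:
  fixes Q r s :: "'z :: topological_space \<Rightarrow> real"
  assumes "continuous_on UNIV Q" "continuous_on UNIV r" "continuous_on UNIV s"
  shows "open {z. generic (Q z) (r z) (s z)}"
  unfolding generic_iff
  by (intro open_Collect_conj open_Collect_less open_Collect_neq continuous_intros assms)

text \<open>The smallest root may vanish, but the second exceeds it. So a factor 1 / R is harmless
  on the range of integration even at degenerate points.\<close>

lemma root2_pos: "generic Q r s \<Longrightarrow> root2 Q r s > 0"
  using zero_le_power2[of "1 - Q"] zero_le_power2[of "r - s"]
  unfolding generic_def four_roots_def root_defs by linarith

lemma generic_interval:
  fixes Q r :: "real \<Rightarrow> real"
  assumes "continuous_on UNIV Q" "continuous_on UNIV r" "generic (Q x) (r x) s"
  obtains a b where "x \<in> {a<..<b}" "\<And>t. t \<in> {a..b} \<Longrightarrow> generic (Q t) (r t) s"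
proof -
  have "open {t. generic (Q t) (r t) s}"
    by (intro open_generic assms continuous_intros)
  then obtain e where "e > 0" "cball x e \<subseteq> {t. generic (Q t) (r t) s}"
    using assms(3) open_contains_cball by blast
  then show ?thesis
    by (intro that[of "x - e" "x + e"]) (auto simp: cball_eq_atLeastAtMost)
qed

lemma heron_eq_0_iff: "heron r s R = 0 \<longleftrightarrow> R = (r - s)\<^sup>2 \<or> R = (r + s)\<^sup>2"
  by (auto simp: heron_def)

text \<open>The moving side enters \<open>cosine\<close> only through - r^2 in the numerator, so the
  weight does not depend on \<open>R\<close>.\<close>

lemma mean_angle_has_derivative_side:
  assumes gen: "generic (exp y) (exp x) (exp u)"
  shows "((\<lambda>t. mean_angle (exp y) (exp t) (exp u)) has_real_derivative
     ell (exp y) (exp x) (exp u) (\<lambda>R. 2 * (exp x)\<^sup>2)) (at x)"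
proof -
  obtain a b where ab: "x \<in> {a<..<b}" "\<And>t. t \<in> {a..b} \<Longrightarrow> generic (exp y) (exp t) (exp u)"
    using generic_interval[of "\<lambda>_. exp y" exp x "exp u"] gen continuous_on_exp[OF continuous_on_id] continuous_on_const by blast
  show ?thesis
  proof (rule mean_angle_has_derivative[OF ab])
    fix \<theta> :: real assume \<theta>: "\<theta> \<in> {0<..<pi}"
    let ?R = "side2 (exp y) \<theta>"
    have R: "?R > 0" using side2_pos[OF _ \<theta>] by simp
    have "{t. heron (exp t) (exp u) ?R = 0} \<subseteq>
        ln ` {exp u + sqrt ?R, exp u - sqrt ?R, - exp u + sqrt ?R, - exp u - sqrt ?R}"
    proof
      fix t assume "t \<in> {t. heron (exp t) (exp u) ?R = 0}"
      then have "sqrt ?R = \<bar>exp t - exp u\<bar> \<or> sqrt ?R = \<bar>exp t + exp u\<bar>"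
        unfolding mem_Collect_eq heron_eq_0_iff by (metis real_sqrt_abs)
      then have "exp t \<in> {exp u + sqrt ?R, exp u - sqrt ?R, - exp u + sqrt ?R, - exp u - sqrt ?R}"
        by (auto simp: abs_if split: if_splits)
      then show "t \<in> ln ` {exp u + sqrt ?R, exp u - sqrt ?R, - exp u + sqrt ?R, - exp u - sqrt ?R}"
        by (intro image_eqI[of _ _ "exp t"]) auto
    qed
    then show "finite {t. heron (exp t) (exp u) ?R = 0}"
      by (rule finite_subset) auto
    fix t
    show "((\<lambda>t. cosine (exp t) (exp u) ?R) has_real_derivative - (2 * (exp t)\<^sup>2) / (2 * exp u * sqrt ?R)) (at t)"
      unfolding cosine_def using R by (auto intro!: derivative_eq_intros simp: power2_eq_square)
    show "- (- (2 * (exp t)\<^sup>2) / (2 * exp u * sqrt ?R)) * (2 * exp u * sqrt ?R) = 2 * (exp t)\<^sup>2"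
      using R by simp
  qed (auto intro!: continuous_intros simp: case_prod_beta)
qed

text \<open>Chain rule through \<open>R\<close>: the two factors of the numerator are, up to
  normalisation, the derivatives of \<open>cosine\<close> in \<open>R\<close> and of
  \<open>R\<close> in the parameter. The denominator \<open>R\<close> comes from the sqrt R inside
  \<open>cosine\<close>.\<close>

lemma mean_angle_has_derivative_modulus:
  assumes gen: "generic (exp x) (exp y) (exp u)"
  shows "((\<lambda>t. mean_angle (exp t) (exp y) (exp u)) has_real_derivative
     ell (exp x) (exp y) (exp u)
       (\<lambda>R. - ((R + ((exp y)\<^sup>2 - (exp u)\<^sup>2)) * (R + ((exp x)\<^sup>2 - 1)) / R) / 2)) (at x)"
proof -
  let ?p = "(exp y)\<^sup>2 - (exp u)\<^sup>2"
  obtain a b where ab: "x \<in> {a<..<b}" "\<And>t. t \<in> {a..b} \<Longrightarrow> generic (exp t) (exp y) (exp u)"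
    using generic_interval[of exp "\<lambda>_. exp y" x "exp u"] gen continuous_on_exp[OF continuous_on_id] continuous_on_const by blast
  show ?thesis
  proof (rule mean_angle_has_derivative[OF ab, where
      w = "\<lambda>t R. - ((R + ?p) * (R + ((exp t)\<^sup>2 - 1)) / R) / 2"])
    have "R \<noteq> 0" if "t \<in> {a..b}" "R \<in> {root2 (exp t) (exp y) (exp u)..root3 (exp t) (exp y) (exp u)}" for t R
      using root2_pos[OF ab(2)[OF that(1)]] that by auto
    then show "continuous_on (SIGMA t:{a..b}. {root2 (exp t) (exp y) (exp u)..root3 (exp t) (exp y) (exp u)})
        (\<lambda>(t, R). - ((R + ?p) * (R + ((exp t)\<^sup>2 - 1)) / R) / 2)"
      unfolding case_prod_beta by (intro continuous_intros) auto
    fix \<theta> :: real assume \<theta>: "\<theta> \<in> {0<..<pi}"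
    \<comment> \<open>Completing the square in the quadratic equation for
      \<open>exp t\<close>.\<close>
    have "{t. side2 (exp t) \<theta> = v} \<subseteq> ln ` {- cos \<theta> + sqrt (v - 1 + (cos \<theta>)\<^sup>2), - cos \<theta> - sqrt (v - 1 + (cos \<theta>)\<^sup>2)}" for v
    proof
      fix t assume "t \<in> {t. side2 (exp t) \<theta> = v}"
      then have "v - 1 + (cos \<theta>)\<^sup>2 = (exp t + cos \<theta>)\<^sup>2"
        by (auto simp: side2_def power2_eq_square algebra_simps)
      then have "sqrt (v - 1 + (cos \<theta>)\<^sup>2) = \<bar>exp t + cos \<theta>\<bar>"
        by simp
      then have "exp t \<in> {- cos \<theta> + sqrt (v - 1 + (cos \<theta>)\<^sup>2), - cos \<theta> - sqrt (v - 1 + (cos \<theta>)\<^sup>2)}"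
        by (auto simp: abs_if split: if_splits)
      then show "t \<in> ln ` {- cos \<theta> + sqrt (v - 1 + (cos \<theta>)\<^sup>2), - cos \<theta> - sqrt (v - 1 + (cos \<theta>)\<^sup>2)}"
        by (intro image_eqI[of _ _ "exp t"]) auto
    qed
    then have "finite {t. side2 (exp t) \<theta> = v}" for v
      by (rule finite_subset) auto
    then show "finite {t. heron (exp y) (exp u) (side2 (exp t) \<theta>) = 0}"
      unfolding heron_eq_0_iff by (simp add: Collect_disj_eq)
    fix t
    let ?R = "side2 (exp t) \<theta>"
    have R: "?R > 0" using side2_pos[OF _ \<theta>] by simp
    have "((\<lambda>t. 1 + (exp t)\<^sup>2 + 2 * exp t * cos \<theta>) has_real_derivative 2 * (exp t)\<^sup>2 + 2 * exp t * cos \<theta>) (at t)"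
      by (auto intro!: derivative_eq_intros simp: power2_eq_square)
    \<comment> \<open>Eliminates the angle in favour of \<open>R\<close>, as the weight must be a
      function of \<open>R\<close>.\<close>
    also have "2 * (exp t)\<^sup>2 + 2 * exp t * cos \<theta> = ?R + ((exp t)\<^sup>2 - 1)"
      by (simp add: side2_def)
    finally have dR: "((\<lambda>t. side2 (exp t) \<theta>) has_real_derivative ?R + ((exp t)\<^sup>2 - 1)) (at t)"
      by (simp add: side2_def[abs_def])
    have "((\<lambda>R. cosine (exp y) (exp u) R) has_real_derivative (?R + ?p) / (2 * ?R * (2 * exp u * sqrt ?R))) (at ?R)"
    proof -
      have sq: "sqrt ?R * sqrt ?R = ?R" using R by simp
      have "((\<lambda>R. cosine (exp y) (exp u) R) has_real_derivative
          (1 * (2 * exp u * sqrt ?R) - (?R + (exp u)\<^sup>2 - (exp y)\<^sup>2) * (2 * exp u * (inverse (sqrt ?R) / 2))) /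
          ((2 * exp u * sqrt ?R) * (2 * exp u * sqrt ?R))) (at ?R)"
        unfolding cosine_def using R
        by (auto intro!: derivative_eq_intros)
      moreover have "(1 * (2 * exp u * sqrt ?R) - (?R + (exp u)\<^sup>2 - (exp y)\<^sup>2) * (2 * exp u * (inverse (sqrt ?R) / 2))) /
          ((2 * exp u * sqrt ?R) * (2 * exp u * sqrt ?R)) = (?R + ?p) / (2 * ?R * (2 * exp u * sqrt ?R))"
      proof -
        define z where "z = sqrt ?R"
        have z: "z > 0" "?R = z * z" using R sq by (auto simp: z_def)
        show ?thesis unfolding z_def[symmetric] unfolding z(2) using z(1) by (simp add: divide_simps) (simp add: algebra_simps)
      qed
      ultimately show ?thesis by (simp only:)
    qed
    from DERIV_chain2[OF this dR]
    show "((\<lambda>t. cosine (exp y) (exp u) (side2 (exp t) \<theta>)) has_real_derivative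
        (?R + ?p) / (2 * ?R * (2 * exp u * sqrt ?R)) * (?R + ((exp t)\<^sup>2 - 1))) (at t)" .
    show "- ((?R + ?p) / (2 * ?R * (2 * exp u * sqrt ?R)) * (?R + ((exp t)\<^sup>2 - 1))) * (2 * exp u * sqrt ?R) =
       - ((?R + ?p) * (?R + ((exp t)\<^sup>2 - 1)) / ?R) / 2"
    proof -
      have cancel: "- (A / (2 * B * C) * D) * C = - (A * D / B) / 2" if "B > 0" "C > 0" for A B C D :: real
        using that by simp
      show ?thesis by (rule cancel) (use R in simp_all)
    qed
  qed (auto intro!: continuous_intros)
qed

section \<open>Complete elliptic integrals\<close>

lemma legendre_const:
  assumes "four_roots A1 A2 A3 A4"
  shows "legendre A1 A2 A3 A4 (\<lambda>_. c) =
    2 / sqrt ((A4 - A2) * (A3 - A1)) * c * ellK (sqrt (legendre_k2 A1 A2 A3 A4))"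
proof -
  interpret four_roots A1 A2 A3 A4 by fact
  have "integral {0..pi / 2} (\<lambda>t. c / sqrt (1 - legendre_k2 A1 A2 A3 A4 * (sin t)\<^sup>2))
      = c * integral {0..pi / 2} (\<lambda>t. 1 / sqrt (1 - legendre_k2 A1 A2 A3 A4 * (sin t)\<^sup>2))"
    by (subst integral_mult_right[symmetric]) simp
  then show ?thesis
    using k2 by (simp add: legendre_def ellK_def k2_def)
qed

lemma legendre_cmult: "legendre A1 A2 A3 A4 (\<lambda>R. c * w R) = c * legendre A1 A2 A3 A4 w"
proof -
  have "integral {0..pi / 2} (\<lambda>t. c * w (legendre_map A1 A2 A3 t) / sqrt (1 - legendre_k2 A1 A2 A3 A4 * (sin t)\<^sup>2))
      = c * integral {0..pi / 2} (\<lambda>t. w (legendre_map A1 A2 A3 t) / sqrt (1 - legendre_k2 A1 A2 A3 A4 * (sin t)\<^sup>2))"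
    by (subst integral_mult_right[symmetric]) simp
  then show ?thesis by (simp add: legendre_def)
qed

text \<open>
  Writing \<open>(R + p) (R + q) / R = R + (p + q) + p q / R\<close>, the term \<open>R\<close> produces the characteristic
  \<open>(A3 - A2) / (A3 - A1)\<close> and the term \<open>p q / R\<close> that value times \<open>A1 / A2\<close>.
\<close>

lemma legendre_third_kind:
  assumes "four_roots A1 A2 A3 A4" and A1: "A1 > 0"
  defines "\<beta> \<equiv> (A3 - A2) / (A3 - A1)"
  defines "k \<equiv> sqrt (legendre_k2 A1 A2 A3 A4)"
  shows "legendre A1 A2 A3 A4 (\<lambda>R. (R + p) * (R + q) / R) =
    2 / sqrt ((A4 - A2) * (A3 - A1)) *
      ((A1 + p) * (A1 + q) / A1 * ellK k + (A2 - A1) * ellPi \<beta> k + p * q * (A1 - A2) / (A1 * A2) * ellPi (\<beta> * (A1 / A2)) k)"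
proof -
  interpret four_roots A1 A2 A3 A4 by fact
  have \<beta>: "\<beta> = \<alpha>" by (simp add: \<beta>_def \<alpha>_def)
  have k: "k\<^sup>2 = k2" using k2 by (simp add: k_def k2_def)
  define \<gamma> where "\<gamma> = \<alpha> * (A1 / A2)"
  have \<gamma>: "0 < \<gamma>" "\<gamma> < \<alpha>" using \<alpha> A1 A12 by (auto simp: \<gamma>_def field_simps)
  have v_pos: "0 < 1 - \<gamma> * (sin t)\<^sup>2" for t
  proof -
    have "\<gamma> * (sin t)\<^sup>2 \<le> \<alpha> * (sin t)\<^sup>2" using \<gamma> by (intro mult_right_mono) auto
    then show ?thesis using u_pos[of t] by linarith
  qed
  let ?d = "\<lambda>t. sqrt (1 - k2 * (sin t)\<^sup>2)"
  have d: "?d t \<noteq> 0" for t using k2_pos[of t] by simp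
  have pointwise: "(\<rho> t + p) * (\<rho> t + q) / \<rho> t =
    (A1 + p) * (A1 + q) / A1 + (A2 - A1) * (1 / (1 - \<alpha> * (sin t)\<^sup>2))
     + p * q * (A1 - A2) / (A1 * A2) * (1 / (1 - \<gamma> * (sin t)\<^sup>2))" for t
  proof -
    define u where "u = 1 - \<alpha> * (sin t)\<^sup>2"
    define v where "v = 1 - \<gamma> * (sin t)\<^sup>2"
    have u: "u > 0" and v: "v > 0" using u_pos v_pos by (auto simp: u_def v_def)
    \<comment> \<open>The right side is \<open>u\<close> times \<open>\<rho> t\<close>; so 1 / R has
      the denominator \<open>A2 * v\<close>, which fixes \<open>\<gamma>\<close>.\<close>
    have vu: "A2 * v = A2 - A1 + A1 * u"
      using A12 A1 by (simp add: v_def u_def \<gamma>_def field_simps)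
    have R: "\<rho> t = A1 + (A2 - A1) / u" by (simp add: \<rho>_eq u_def)
    have R': "\<rho> t = A2 * v / u" using u by (simp add: R vu field_simps)
    have Rpos: "\<rho> t > 0" using R' u v A1 A12 by simp
    have "1 / \<rho> t = 1 / A1 + (A1 - A2) / (A1 * A2) * (1 / v)"
    proof -
      have "1 / \<rho> t = A1 * u / (A1 * (A2 * v))" using R' A1 u by simp
      also have "A1 * u = A2 * v + (A1 - A2)" using vu by simp
      also have "(A2 * v + (A1 - A2)) / (A1 * (A2 * v)) = 1 / A1 + (A1 - A2) / (A1 * A2) * (1 / v)"
        using A1 A12 v by (simp add: add_divide_distrib)
      finally show ?thesis .
    qed
    have "(\<rho> t + p) * (\<rho> t + q) / \<rho> t = \<rho> t + (p + q) + p * q * (1 / \<rho> t)"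
      using Rpos by (simp add: field_simps)
    also have "\<dots> = (A1 + (A2 - A1) * (1 / u)) + (p + q) + p * q * (1 / A1 + (A1 - A2) / (A1 * A2) * (1 / v))"
      unfolding \<open>1 / \<rho> t = _\<close> by (simp add: R)
    also have "\<dots> = (A1 + (p + q) + p * q / A1) + (A2 - A1) * (1 / u) + p * q * (A1 - A2) / (A1 * A2) * (1 / v)"
    proof -
      have "p * q * (1 / A1 + B * (1 / v)) = p * q / A1 + p * q * B * (1 / v)" for B
        by (simp add: distrib_left)
      from this[of "(A1 - A2) / (A1 * A2)"] show ?thesis
        unfolding times_divide_eq_right[of "p * q"] by linarith
    qed
    also have "A1 + (p + q) + p * q / A1 = (A1 + p) * (A1 + q) / A1"
      using A1 by (simp add: field_simps)
    finally show ?thesis by (simp add: u_def v_def)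
  qed
  have split: "(\<rho> t + p) * (\<rho> t + q) / \<rho> t / ?d t =
      (A1 + p) * (A1 + q) / A1 * (1 / ?d t) + (A2 - A1) * (1 / ((1 - \<alpha> * (sin t)\<^sup>2) * ?d t))
     + p * q * (A1 - A2) / (A1 * A2) * (1 / ((1 - \<gamma> * (sin t)\<^sup>2) * ?d t))" for t
    unfolding pointwise by (simp add: add_divide_distrib)
  have un: "1 - \<alpha> * (sin t)\<^sup>2 \<noteq> 0" "1 - \<gamma> * (sin t)\<^sup>2 \<noteq> 0" for t
    using u_pos[of t] v_pos[of t] by linarith+
  have K: "((\<lambda>t. 1 / ?d t) has_integral ellK k) {0..pi / 2}"
    unfolding ellK_def k using d by (intro integrable_integral integrable_continuous_real continuous_intros) auto
  have P1: "((\<lambda>t. 1 / ((1 - \<alpha> * (sin t)\<^sup>2) * ?d t)) has_integral ellPi \<alpha> k) {0..pi / 2}"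
    unfolding ellPi_def k using d un
    by (intro integrable_integral integrable_continuous_real continuous_intros) (auto simp del: real_sqrt_eq_0_iff)
  have P2: "((\<lambda>t. 1 / ((1 - \<gamma> * (sin t)\<^sup>2) * ?d t)) has_integral ellPi \<gamma> k) {0..pi / 2}"
    unfolding ellPi_def k using d un
    by (intro integrable_integral integrable_continuous_real continuous_intros) (auto simp del: real_sqrt_eq_0_iff)
  have "((\<lambda>t. (\<rho> t + p) * (\<rho> t + q) / \<rho> t / ?d t) has_integral
      (A1 + p) * (A1 + q) / A1 * ellK k + (A2 - A1) * ellPi \<alpha> k + p * q * (A1 - A2) / (A1 * A2) * ellPi \<gamma> k) {0..pi / 2}"
    unfolding split by (intro has_integral_add has_integral_mult_right K P1 P2)
  from integral_unique[OF this] show ?thesis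
    unfolding legendre_def k2_def[symmetric] \<rho>_def[symmetric] \<beta> \<gamma>_def by simp
qed

text \<open>On \<open>generic\<close> triples it is positive when the two intervals are interlaced
  and negative when one contains the other.\<close>

definition sign_product :: "real \<Rightarrow> real \<Rightarrow> real \<Rightarrow> real" where
  "sign_product a b c = (1 + a - b - c) * (1 + b - a - c) * (1 + c - a - b)"

text \<open>Interlaced intervals pair each upper end with the lower end of its own interval, giving
  4 a times 4 b c; nested ones pair across, giving \<open>xi\<close>. The numerator of the modulus
  uses the opposite pairing, so the two products trade places.\<close>

lemma root_differences:
  assumes "generic a b c"
  defines "D \<equiv> (root4 a b c - root2 a b c) * (root3 a b c - root1 a b c)"
  shows "sign_product a b c > 0 \<Longrightarrow> D = 16 * (a * b * c) \<and>
      legendre_k2 (root1 a b c) (root2 a b c) (root3 a b c) (root4 a b c) = xi a b c / (16 * (a * b * c))"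
    and "sign_product a b c < 0 \<Longrightarrow> D = xi a b c \<and>
      legendre_k2 (root1 a b c) (root2 a b c) (root3 a b c) (root4 a b c) = 16 * (a * b * c) / xi a b c"
proof -
  have pos: "a > 0" "b > 0" "c > 0" using assms by (auto simp: generic_def)
  let ?d = "(1 + b - a - c) * (1 + c - a - b)" and ?e = "1 + a - b - c"
  have m: "(1 - a)\<^sup>2 - (b - c)\<^sup>2 = ?d" by (simp add: power2_eq_square algebra_simps)
  have M: "(1 + a)\<^sup>2 - (b + c)\<^sup>2 = ?e * (1 + a + b + c)" by (simp add: power2_eq_square algebra_simps)
  have sp: "sign_product a b c = ?e * ?d" by (simp add: sign_product_def)
  have x: "xi a b c = ((1 + a)\<^sup>2 - (b - c)\<^sup>2) * ((b + c)\<^sup>2 - (1 - a)\<^sup>2)"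
    by (simp add: xi_def power2_eq_square algebra_simps)
  have y: "16 * (a * b * c) = ((1 + a)\<^sup>2 - (1 - a)\<^sup>2) * ((b + c)\<^sup>2 - (b - c)\<^sup>2)"
    by (simp add: power2_eq_square algebra_simps)
  have e: "(1 + a)\<^sup>2 > (b + c)\<^sup>2 \<longleftrightarrow> ?e > 0" "(1 + a)\<^sup>2 < (b + c)\<^sup>2 \<longleftrightarrow> ?e < 0"
    using M pos zero_less_mult_iff[of ?e "1 + a + b + c"] mult_less_0_iff[of ?e "1 + a + b + c"] by linarith+
  have d: "(1 - a)\<^sup>2 > (b - c)\<^sup>2 \<longleftrightarrow> ?d > 0" "(1 - a)\<^sup>2 < (b - c)\<^sup>2 \<longleftrightarrow> ?d < 0"
    using m by linarith+
  {
    assume "sign_product a b c > 0"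
    then consider "?e > 0" "?d > 0" | "?e < 0" "?d < 0"
      unfolding sp zero_less_mult_iff by blast
    then show "D = 16 * (a * b * c) \<and>
      legendre_k2 (root1 a b c) (root2 a b c) (root3 a b c) (root4 a b c) = xi a b c / (16 * (a * b * c))"
    proof cases
      case 1
      then have "(1 + a)\<^sup>2 > (b + c)\<^sup>2" "(1 - a)\<^sup>2 > (b - c)\<^sup>2" using e d by blast+
      then show ?thesis unfolding D_def legendre_k2_def x y by (simp add: root_defs)
    next
      case 2
      then have "(1 + a)\<^sup>2 < (b + c)\<^sup>2" "(1 - a)\<^sup>2 < (b - c)\<^sup>2" using e d by blast+
      then show ?thesis unfolding D_def legendre_k2_def x y by (simp add: root_defs mult.commute)
    qed
  next
    assume "sign_product a b c < 0"
    then consider "?e > 0" "?d < 0" | "?e < 0" "?d > 0"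
      unfolding sp mult_less_0_iff by blast
    then show "D = xi a b c \<and>
      legendre_k2 (root1 a b c) (root2 a b c) (root3 a b c) (root4 a b c) = 16 * (a * b * c) / xi a b c"
    proof cases
      case 1
      then have "(1 + a)\<^sup>2 > (b + c)\<^sup>2" "(1 - a)\<^sup>2 < (b - c)\<^sup>2" using e d by blast+
      then show ?thesis unfolding D_def legendre_k2_def x y by (simp add: root_defs)
    next
      case 2
      then have "(1 + a)\<^sup>2 < (b + c)\<^sup>2" "(1 - a)\<^sup>2 > (b - c)\<^sup>2" using e d by blast+
      then show ?thesis unfolding D_def legendre_k2_def x y by (simp add: root_defs mult.commute)
    qed
  }
qed

section \<open>Critical points and chambers\<close>

lemma ln_norm_has_derivative:
  fixes z :: complex
  assumes "z \<noteq> 0"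
  shows "((\<lambda>z. ln (cmod z)) has_derivative (\<lambda>v. (v \<bullet> sgn z) / cmod z)) (at z)"
  using assms by (auto intro!: derivative_eq_intros has_derivative_norm simp: divide_inverse)

lemma Log3_has_derivative:
  assumes "z \<noteq> 0" "w \<noteq> 0" "t \<noteq> 0"
  shows "(Log3 has_derivative (\<lambda>v. ((fst v \<bullet> sgn z) / cmod z, (fst (snd v) \<bullet> sgn w) / cmod w, (snd (snd v) \<bullet> sgn t) / cmod t)))
    (at (z, w, t))"
proof -
  have "((\<lambda>p. ln (cmod (fst p))) has_derivative (\<lambda>v. (fst v \<bullet> sgn z) / cmod z)) (at (z, w, t))"
    using has_derivative_compose[OF has_derivative_fst[OF has_derivative_ident], of "\<lambda>z. ln (cmod z)" _ "(z, w, t)"]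
      ln_norm_has_derivative[OF assms(1)] by simp
  moreover have "((\<lambda>p. ln (cmod (fst (snd p)))) has_derivative (\<lambda>v. (fst (snd v) \<bullet> sgn w) / cmod w)) (at (z, w, t))"
    using has_derivative_compose[OF has_derivative_fst[OF has_derivative_snd[OF has_derivative_ident]], of "\<lambda>z. ln (cmod z)" _ "(z, w, t)"]
      ln_norm_has_derivative[OF assms(2)] by simp
  moreover have "((\<lambda>p. ln (cmod (snd (snd p)))) has_derivative (\<lambda>v. (snd (snd v) \<bullet> sgn t) / cmod t)) (at (z, w, t))"
    using has_derivative_compose[OF has_derivative_snd[OF has_derivative_snd[OF has_derivative_ident]], of "\<lambda>z. ln (cmod z)" _ "(z, w, t)"]
      ln_norm_has_derivative[OF assms(3)] by simp
  ultimately have "((\<lambda>p. (ln (cmod (fst p)), ln (cmod (fst (snd p))), ln (cmod (snd (snd p))))) has_derivative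
     (\<lambda>v. ((fst v \<bullet> sgn z) / cmod z, (fst (snd v) \<bullet> sgn w) / cmod w, (snd (snd v) \<bullet> sgn t) / cmod t))) (at (z, w, t))"
    by (intro has_derivative_Pair)
  then show ?thesis by (simp add: Log3_def case_prod_beta')
qed

lemma lin_poly_has_derivative:
  "(lin_poly has_derivative (\<lambda>v. fst v + fst (snd v) + snd (snd v))) (at p)"
  unfolding lin_poly_def case_prod_beta' by (auto intro!: derivative_eq_intros)

text \<open>
  At a real zero the real parts of a tangent vector add up to zero, which is a linear relation
  between the coordinates of its image.
\<close>

lemma real_zero_in_contour:
  fixes p q r :: real
  assumes "1 + p + q + r = 0" "p \<noteq> 0" "q \<noteq> 0" "r \<noteq> 0"
  shows "(ln \<bar>p\<bar>, ln \<bar>q\<bar>, ln \<bar>r\<bar>) \<in> contour lin_poly"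
proof -
  let ?P = "(of_real p, of_real q, of_real r) :: complex \<times> complex \<times> complex"
  have zero: "?P \<in> zero_locus lin_poly"
  proof -
    have "complex_of_real (1 + p + q + r) = 0" by (simp only: assms of_real_0)
    then show ?thesis using assms(2-4) by (simp add: zero_locus_def torus_points_def lin_poly_def)
  qed
  have dL: "frechet_derivative Log3 (at ?P) = (\<lambda>v. ((fst v \<bullet> sgn (of_real p)) / \<bar>p\<bar>,
      (fst (snd v) \<bullet> sgn (of_real q)) / \<bar>q\<bar>, (snd (snd v) \<bullet> sgn (of_real r)) / \<bar>r\<bar>))"
    using frechet_derivative_at[OF Log3_has_derivative[of "of_real p" "of_real q" "of_real r"]] assms by simp
  have dl: "frechet_derivative lin_poly (at ?P) = (\<lambda>v. fst v + fst (snd v) + snd (snd v))"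
    by (rule frechet_derivative_at[OF lin_poly_has_derivative, symmetric])
  have inner: "v \<bullet> sgn (complex_of_real s) / \<bar>s\<bar> = Re v / s" if "s \<noteq> 0" for v s
    using that by (simp add: sgn_of_real inner_complex_def sgn_if)
  have "(1, 0, 0) \<notin> frechet_derivative Log3 (at ?P) ` {v. frechet_derivative lin_poly (at ?P) v = 0}"
  proof
    assume "(1, 0, 0) \<in> frechet_derivative Log3 (at ?P) ` {v. frechet_derivative lin_poly (at ?P) v = 0}"
    then obtain v1 v2 v3 :: complex where v: "v1 + v2 + v3 = 0" "Re v1 / p = 1" "Re v2 / q = 0" "Re v3 / r = 0"
      unfolding dL dl using inner assms by auto
    then have "Re v1 + Re v2 + Re v3 = 0" by (metis plus_complex.sel(1) zero_complex.sel(1))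
    then show False using v assms by simp
  qed
  then have "frechet_derivative Log3 (at ?P) ` {v. frechet_derivative lin_poly (at ?P) v = 0} \<noteq> UNIV"
    by blast
  then show ?thesis
    unfolding contour_def using zero by (intro image_eqI[of _ _ ?P]) (auto simp: Log3_def)
qed

text \<open>The zero gives weak quadrilateral inequalities. Any vanishing 1 +- a +- b +- c would
  produce a real zero with the same moduli, hence a contour point; this makes them strict and the
  chamber forms nonzero.\<close>

lemma generic_of_amoeba:
  assumes "(x, y, u) \<in> amoeba lin_poly - contour lin_poly"
  shows "generic (exp x) (exp y) (exp u)"
proof -
  obtain z w t where zwt: "z \<noteq> 0" "w \<noteq> 0" "t \<noteq> 0" "1 + z + w + t = 0"
     "x = ln (cmod z)" "y = ln (cmod w)" "u = ln (cmod t)"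
    using assms by (auto simp: amoeba_def zero_locus_def torus_points_def lin_poly_def Log3_def)
  have n: "exp x = cmod z" "exp y = cmod w" "exp u = cmod t" using zwt by auto
  have *: "cmod a \<le> cmod b + cmod c + cmod d" if "a + b + c + d = 0" for a b c d :: complex
  proof -
    have "a = - (b + c + d)" using that by (metis add.assoc eq_neg_iff_add_eq_0)
    then have "cmod a = cmod (b + c + d)" by (metis norm_minus_cancel)
    then show ?thesis using norm_triangle_ineq[of "b + c" d] norm_triangle_ineq[of b c] by linarith
  qed
  have le: "1 \<le> exp x + exp y + exp u" "exp x \<le> 1 + exp y + exp u" "exp y \<le> 1 + exp x + exp u" "exp u \<le> 1 + exp x + exp y"
    using *[of 1 z w t] *[of z 1 w t] *[of w 1 z t] *[of t 1 z w] zwt(4) unfolding n by (auto simp: algebra_simps)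
  have ne: "1 + i * exp x + j * exp y + k * exp u \<noteq> 0" if "\<bar>i\<bar> = 1" "\<bar>j\<bar> = 1" "\<bar>k\<bar> = 1" for i j k :: real
  proof
    assume "1 + i * exp x + j * exp y + k * exp u = 0"
    then have "(ln \<bar>i * exp x\<bar>, ln \<bar>j * exp y\<bar>, ln \<bar>k * exp u\<bar>) \<in> contour lin_poly"
      using that by (intro real_zero_in_contour) auto
    then show False using assms that by (simp add: abs_mult)
  qed
  show ?thesis
    unfolding generic_iff
    using le ne[of "-1" "-1" "-1"] ne[of "-1" 1 1] ne[of 1 "-1" 1] ne[of 1 1 "-1"]
      ne[of 1 "-1" "-1"] ne[of "-1" 1 "-1"] ne[of "-1" "-1" 1] by auto
qed

text \<open>Chambers are grouped by the first sign, which orders the upper ends, and by the product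
  of the other two, which orders the lower ends.\<close>

lemma coeffs_at_cases:
  assumes gen: "generic (exp x) (exp y) (exp u)"
  defines "a \<equiv> exp x" and "b \<equiv> exp y" and "c \<equiv> exp u"
  obtains
    (A) "b + c < 1 + a" "(b - c)\<^sup>2 < (1 - a)\<^sup>2" "sign_product a b c > 0" "coeffs_at (x, y, u) = coeffs_A a b c"
  | (B) "1 + a < b + c" "(b - c)\<^sup>2 < (1 - a)\<^sup>2" "sign_product a b c < 0" "coeffs_at (x, y, u) = coeffs_B a b c"
  | (C) "1 + a < b + c" "(1 - a)\<^sup>2 < (b - c)\<^sup>2" "sign_product a b c > 0" "coeffs_at (x, y, u) = coeffs_C a b c"
  | (D) "b + c < 1 + a" "(1 - a)\<^sup>2 < (b - c)\<^sup>2" "sign_product a b c < 0" "coeffs_at (x, y, u) = coeffs_D a b c"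
proof -
  let ?e1 = "1 + a - b - c" and ?e2 = "1 + b - a - c" and ?e3 = "1 + c - a - b"
  have "?e1 \<noteq> 0" "?e2 \<noteq> 0" "?e3 \<noteq> 0"
    using gen by (auto simp: generic_iff a_def b_def c_def)
  then have s: "?e1 > 0 \<or> ?e1 < 0" "?e2 > 0 \<or> ?e2 < 0" "?e3 > 0 \<or> ?e3 < 0" by linarith+
  have ch: "chamber (x, y, u) = (sgn ?e1, sgn ?e2, sgn ?e3)"
    by (simp add: chamber_def a_def b_def c_def)
  have m: "(1 - a)\<^sup>2 - (b - c)\<^sup>2 = ?e2 * ?e3" by (simp add: power2_eq_square algebra_simps)
  have sp: "sign_product a b c = ?e1 * (?e2 * ?e3)" by (simp add: sign_product_def)
  consider "?e1 > 0" "?e2 * ?e3 > 0" | "?e1 < 0" "?e2 * ?e3 > 0" | "?e1 < 0" "?e2 * ?e3 < 0" | "?e1 > 0" "?e2 * ?e3 < 0"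
    using s by (auto simp: zero_less_mult_iff mult_less_0_iff)
  then show ?thesis
  proof cases
    case 1
    then have "chamber (x, y, u) \<in> {(1, 1, 1), (1, -1, -1)}"
      unfolding ch by (auto simp: zero_less_mult_iff sgn_if)
    then show ?thesis using 1 m sp by (intro A) (auto simp: coeffs_at_def a_def b_def c_def)
  next
    case 2
    then have "chamber (x, y, u) \<in> {(-1, 1, 1), (-1, -1, -1)}"
      unfolding ch by (auto simp: zero_less_mult_iff sgn_if)
    then show ?thesis using 2 m sp mult_neg_pos[OF 2] by (intro B) (auto simp: coeffs_at_def a_def b_def c_def)
  next
    case 3
    then have "chamber (x, y, u) \<in> {(-1, -1, 1), (-1, 1, -1)}"
      unfolding ch by (auto simp: mult_less_0_iff sgn_if)
    then show ?thesis using 3 m sp mult_neg_neg[OF 3] by (intro C) (auto simp: coeffs_at_def a_def b_def c_def)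
  next
    case 4
    then have "chamber (x, y, u) \<in> {(1, -1, 1), (1, 1, -1)}"
      unfolding ch by (auto simp: mult_less_0_iff sgn_if)
    then show ?thesis using 4 m sp mult_pos_neg[OF 4] by (intro D) (auto simp: coeffs_at_def a_def b_def c_def)
  qed
qed

section \<open>Matching the stated coefficients with the branch points\<close>

lemma two_div_sqrt_16: "0 \<le> v \<Longrightarrow> 2 / sqrt (16 * v) = 1 / (2 * sqrt v)"
  by (simp add: real_sqrt_mult)

lemma g_and_modulus:
  assumes gen: "generic (exp x) (exp y) (exp u)"
  defines "a \<equiv> exp x" and "b \<equiv> exp y" and "c \<equiv> exp u"
  shows "cf_g (coeffs_at (x, y, u)) = 2 / sqrt ((root4 a b c - root2 a b c) * (root3 a b c - root1 a b c))"
    and "modulus_at (x, y, u) = sqrt (legendre_k2 (root1 a b c) (root2 a b c) (root3 a b c) (root4 a b c))"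
proof -
  note rd = root_differences[OF gen, folded a_def b_def c_def]
  have pos: "0 \<le> a * b * c" by (simp add: a_def b_def c_def)
  have "cf_g (coeffs_at (x, y, u)) = 2 / sqrt ((root4 a b c - root2 a b c) * (root3 a b c - root1 a b c)) \<and>
    cf_k2 (coeffs_at (x, y, u)) = legendre_k2 (root1 a b c) (root2 a b c) (root3 a b c) (root4 a b c)"
  proof (cases rule: coeffs_at_cases[OF gen, folded a_def b_def c_def, case_names A B C D])
    case A
    then show ?thesis using rd(1) pos by (simp add: coeffs_A_def Let_def two_div_sqrt_16)
  next
    case B
    then show ?thesis using rd(2) by (simp add: coeffs_B_def Let_def)
  next
    case C
    then show ?thesis using rd(1) pos by (simp add: coeffs_C_def Let_def two_div_sqrt_16)
  next
    case D
    then show ?thesis using rd(2) by (simp add: coeffs_D_def Let_def)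
  qed
  then show "cf_g (coeffs_at (x, y, u)) = 2 / sqrt ((root4 a b c - root2 a b c) * (root3 a b c - root1 a b c))"
    "modulus_at (x, y, u) = sqrt (legendre_k2 (root1 a b c) (root2 a b c) (root3 a b c) (root4 a b c))"
    by (simp_all add: modulus_at_def)
qed

lemma generic_swap: "generic b a c \<longleftrightarrow> generic a b c"
  by (auto simp: generic_iff algebra_simps)

text \<open>The pure derivative arises with modulus b and side a, the stated coefficients with
  modulus a and side b. For a constant weight only \<open>sign_product\<close>, the product a b c
  and \<open>xi\<close> matter, and these are symmetric.\<close>

lemma ell_const_swap:
  assumes gen: "generic a b c"
  shows "ell b a c (\<lambda>_. v) = ell a b c (\<lambda>_. v)"
proof -
  have gen': "generic b a c" using gen by (simp add: generic_swap)
  have sw: "sign_product b a c = sign_product a b c" "b * a * c = a * b * c" "xi b a c = xi a b c"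
    by (simp_all add: sign_product_def xi_def algebra_simps)
  have "sign_product a b c \<noteq> 0" using gen by (auto simp: generic_iff sign_product_def)
  then have "sign_product a b c > 0 \<or> sign_product a b c < 0" by linarith
  then show ?thesis
    using root_differences[OF gen] root_differences[OF gen'] gen gen'
    unfolding ell_def generic_def sw by (auto simp: legendre_const)
qed

lemma rhs_xx_eq_ell:
  assumes gen: "generic (exp x) (exp y) (exp u)"
  shows "rhs_xx (x, y, u) = ell (exp y) (exp x) (exp u) (\<lambda>_. 2 * (exp x)\<^sup>2) / pi\<^sup>2"
proof -
  have "exp (2 * x) = (exp x)\<^sup>2" by (simp add: exp_double)
  then show ?thesis
    unfolding ell_const_swap[OF gen]
    using gen by (simp add: rhs_xx_def g_and_modulus[OF gen] ell_def generic_def legendre_const)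
qed

text \<open>The unsplit integral, which also makes sense where the smallest root is 0.\<close>

definition mixed_partial :: "real \<Rightarrow> real \<Rightarrow> real \<Rightarrow> real" where
  "mixed_partial a b c = ell a b c (\<lambda>R. - ((R + (b\<^sup>2 - c\<^sup>2)) * (R + (a\<^sup>2 - 1)) / R) / 2) / pi\<^sup>2"

text \<open>The smallest root is (b - c)^2 in groups A and B and (1 - a)^2 in C and D. This accounts
  for the two shapes of \<open>cf_Q1\<close>, for the sign change of \<open>cf_Q2\<close> and
  \<open>cf_Q3\<close>, and for the inverted ratio in \<open>cf_\<alpha>2sq\<close>.\<close>

lemma third_kind_coeffs:
  assumes gen: "generic (exp x) (exp y) (exp u)" and nd: "(x, y, u) \<in> nondegenerate"
  defines "a \<equiv> exp x" and "b \<equiv> exp y" and "c \<equiv> exp u" and "X \<equiv> coeffs_at (x, y, u)"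
  defines "p \<equiv> b\<^sup>2 - c\<^sup>2" and "q \<equiv> a\<^sup>2 - 1"
  defines "A1 \<equiv> root1 a b c" and "A2 \<equiv> root2 a b c" and "A3 \<equiv> root3 a b c"
  shows "cf_Q1 X = (A1 + p) * (A1 + q) / A1" "cf_Q2 X = A2 - A1" "cf_Q3 X = p * q * (A1 - A2) / (A1 * A2)"
    "cf_\<alpha>1sq X = (A3 - A2) / (A3 - A1)" "cf_\<alpha>2sq X = (A3 - A2) / (A3 - A1) * (A1 / A2)"
proof -
  have ne: "a - 1 \<noteq> 0" "b - c \<noteq> 0" using nd by (auto simp: nondegenerate_def a_def b_def c_def)
  have pos: "a > 0" "b > 0" "c > 0" by (simp_all add: a_def b_def c_def)
  have sq: "v < w \<Longrightarrow> 0 < v \<Longrightarrow> v\<^sup>2 < w\<^sup>2" for v w :: real by (simp add: power_strict_mono)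
  define Q1 where "Q1 m = (m + p) * (m + q) / m" for m
  have Q1AB: "Q1 ((b - c)\<^sup>2) = 2 * (b * (a\<^sup>2 + b\<^sup>2 + c\<^sup>2 - 1 - 2 * (b * c)) / (b - c))"
  proof -
    have "(b - c)\<^sup>2 + p = (b - c) * (2 * b)" "(b - c)\<^sup>2 + q = a\<^sup>2 + b\<^sup>2 + c\<^sup>2 - 1 - 2 * (b * c)"
      by (simp_all add: p_def q_def power2_eq_square algebra_simps)
    then show ?thesis using ne by (simp add: Q1_def power2_eq_square)
  qed
  have Q1CD: "Q1 ((1 - a)\<^sup>2) = 2 * (a * (a\<^sup>2 + b\<^sup>2 - c\<^sup>2 + 1 - 2 * a) / (a - 1))"
  proof -
    have "(1 - a)\<^sup>2 + q = (a - 1) * (2 * a)" "(1 - a)\<^sup>2 + p = a\<^sup>2 + b\<^sup>2 - c\<^sup>2 + 1 - 2 * a" "(1 - a)\<^sup>2 = (a - 1) * (a - 1)"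
      by (simp_all add: p_def q_def power2_eq_square algebra_simps)
    then show ?thesis using ne by (simp add: Q1_def)
  qed
  have Q2: "(1 - a)\<^sup>2 - (b - c)\<^sup>2 = (1 - a + b - c) * (1 - a - b + c)"
    by (simp add: power2_eq_square algebra_simps)
  then have Q2': "(b - c)\<^sup>2 - (1 - a)\<^sup>2 = - ((1 - a + b - c) * (1 - a - b + c))"
    by simp
  have Q3: "p * q * (- v) / ((b - c)\<^sup>2 * (1 - a)\<^sup>2) = (c + b) * (1 + a) * v / ((c - b) * (a - 1))" for v
  proof -
    have "p * q = ((b - c) * (a - 1)) * ((c + b) * (1 + a))"
      by (simp add: p_def q_def power2_eq_square algebra_simps)
    moreover have "(b - c)\<^sup>2 * (1 - a)\<^sup>2 = ((b - c) * (a - 1)) * ((b - c) * (a - 1))"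
      by (simp add: power2_eq_square algebra_simps)
    moreover have "(c - b) * (a - 1) = - ((b - c) * (a - 1))" by (simp add: algebra_simps)
    ultimately show ?thesis using ne by simp
  qed
  have d: "(1 + a)\<^sup>2 - (1 - a)\<^sup>2 = 4 * a" "(b + c)\<^sup>2 - (b - c)\<^sup>2 = 4 * (b * c)"
    "(b + c)\<^sup>2 - (1 - a)\<^sup>2 = (1 - a + b + c) * (-1 + a + b + c)"
    "(1 + a)\<^sup>2 - (b - c)\<^sup>2 = (1 + a + b - c) * (1 + a - b + c)"
    by (simp_all add: power2_eq_square algebra_simps)
  have "cf_Q1 X = Q1 A1 \<and> cf_Q2 X = A2 - A1 \<and> cf_Q3 X = p * q * (A1 - A2) / (A1 * A2) \<and>
    cf_\<alpha>1sq X = (A3 - A2) / (A3 - A1) \<and> cf_\<alpha>2sq X = (A3 - A2) / (A3 - A1) * (A1 / A2)"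
  proof (cases rule: coeffs_at_cases[OF gen, folded a_def b_def c_def X_def, case_names A B C D])
    case A
    have r: "A1 = (b - c)\<^sup>2" "A2 = (1 - a)\<^sup>2" "A3 = (b + c)\<^sup>2"
      using A sq[of "b + c" "1 + a"] pos by (auto simp: A1_def A2_def A3_def root_defs)
    show ?thesis unfolding r Q1AB Q2 A(4) coeffs_A_def
      using Q3[of "(1 - a + b - c) * (1 - a - b + c)"] by (simp add: Q2 Q2' d Let_def mult_ac)
  next
    case B
    have r: "A1 = (b - c)\<^sup>2" "A2 = (1 - a)\<^sup>2" "A3 = (1 + a)\<^sup>2"
      using B sq[of "1 + a" "b + c"] pos by (auto simp: A1_def A2_def A3_def root_defs)
    show ?thesis unfolding r Q1AB Q2 B(4) coeffs_B_def
      using Q3[of "(1 - a + b - c) * (1 - a - b + c)"] by (simp add: Q2 Q2' d Let_def mult_ac)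
  next
    case C
    have r: "A1 = (1 - a)\<^sup>2" "A2 = (b - c)\<^sup>2" "A3 = (1 + a)\<^sup>2"
      using C sq[of "1 + a" "b + c"] pos by (auto simp: A1_def A2_def A3_def root_defs)
    show ?thesis unfolding r Q1CD C(4) coeffs_C_def
      using Q3[of "- ((1 - a + b - c) * (1 - a - b + c))"] by (simp add: Q2 Q2' d Let_def mult_ac power2_commute[of a 1])
  next
    case D
    have r: "A1 = (1 - a)\<^sup>2" "A2 = (b - c)\<^sup>2" "A3 = (b + c)\<^sup>2"
      using D sq[of "b + c" "1 + a"] pos by (auto simp: A1_def A2_def A3_def root_defs)
    \<comment> \<open>In group D the first coefficient is stated with the opposite sign in numerator
      and denominator.\<close>
    have flip: "- 2 * (v / (1 - a)) = 2 * (v / (a - 1))" for v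
      using minus_divide_divide[of v "1 - a"] by simp
    show ?thesis unfolding r Q1CD D(4) coeffs_D_def flip
      using Q3[of "- ((1 - a + b - c) * (1 - a - b + c))"] by (simp add: Q2 Q2' d Let_def mult_ac)
  qed
  then show "cf_Q1 X = (A1 + p) * (A1 + q) / A1" "cf_Q2 X = A2 - A1" "cf_Q3 X = p * q * (A1 - A2) / (A1 * A2)"
    "cf_\<alpha>1sq X = (A3 - A2) / (A3 - A1)" "cf_\<alpha>2sq X = (A3 - A2) / (A3 - A1) * (A1 / A2)"
    by (simp_all add: Q1_def)
qed

lemma rhs_xy_eq_mixed_partial:
  assumes gen: "generic (exp x) (exp y) (exp u)" and nd: "(x, y, u) \<in> nondegenerate"
  shows "rhs_xy (x, y, u) = mixed_partial (exp x) (exp y) (exp u)"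
proof -
  let ?a = "exp x" and ?b = "exp y" and ?c = "exp u"
  have four: "four_roots (root1 ?a ?b ?c) (root2 ?a ?b ?c) (root3 ?a ?b ?c) (root4 ?a ?b ?c)"
    using gen by (simp add: generic_def)
  \<comment> \<open>Nondegeneracy says exactly that both lower ends are nonzero, which permits the
    splitting.\<close>
  have r1: "root1 ?a ?b ?c > 0"
    using nd by (simp add: root1_def nondegenerate_def)
  have "mixed_partial ?a ?b ?c = (- 1 / 2) * ell ?a ?b ?c (\<lambda>R. (R + (?b\<^sup>2 - ?c\<^sup>2)) * (R + (?a\<^sup>2 - 1)) / R) / pi\<^sup>2"
  proof -
    have "(\<lambda>R. - w R / 2) = (\<lambda>R. (- 1 / 2) * w R)" for w :: "real \<Rightarrow> real"
      by (simp add: fun_eq_iff)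
    then show ?thesis
      unfolding mixed_partial_def ell_def legendre_cmult[symmetric] by (simp only:)
  qed
  moreover have "- g / (2 * P) * S = (- 1 / 2) * (g * S) / P" for g P S :: real
    by simp
  ultimately show ?thesis
    unfolding ell_def legendre_third_kind[OF four r1] rhs_xy_def Let_def
      g_and_modulus[OF gen] third_kind_coeffs[OF gen nd] by (simp only:)
qed

lemma continuous_on_mixed_partial:
  "continuous_on {(x, y, u). generic (exp x) (exp y) (exp u)} (\<lambda>(x, y, u). mixed_partial (exp x) (exp y) (exp u))"
proof -
  let ?U = "{(x, y, u). generic (exp x) (exp y) (exp u)}"
  let ?a = "\<lambda>z :: real \<times> real \<times> real. exp (fst z)" and ?b = "\<lambda>z :: real \<times> real \<times> real. exp (fst (snd z))"
    and ?c = "\<lambda>z :: real \<times> real \<times> real. exp (snd (snd z))"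
  have ne: "R \<noteq> 0" if "z \<in> ?U" "R \<in> {root2 (?a z) (?b z) (?c z)..root3 (?a z) (?b z) (?c z)}" for z R
    using root2_pos[of "?a z" "?b z" "?c z"] that by auto
  have "continuous_on ?U (\<lambda>z. ell (?a z) (?b z) (?c z) (\<lambda>R. - ((R + ((?b z)\<^sup>2 - (?c z)\<^sup>2)) * (R + ((?a z)\<^sup>2 - 1)) / R) / 2))"
    by (intro continuous_on_ell continuous_intros)
      (use ne in \<open>auto simp: case_prod_beta intro!: continuous_intros\<close>)
  then show ?thesis
    unfolding mixed_partial_def case_prod_beta by (intro continuous_intros) auto
qed

theorem proposition3p8:
  fixes x y u :: real
  assumes "(x, y, u) \<in> amoeba lin_poly - contour lin_poly"
  shows "has_partial_xx (ronkin lin_poly) (rhs_xx (x, y, u)) (x, y, u) \<and>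
         (\<exists>d. has_partial_xy (ronkin lin_poly) d (x, y, u) \<and>
              extends_to rhs_xy nondegenerate (x, y, u) d)"
proof
  have gen: "generic (exp x) (exp y) (exp u)"
    by (rule generic_of_amoeba[OF assms])
  have dx: "deriv (\<lambda>r. ronkin lin_poly (r, y, u)) = (\<lambda>s. mean_angle (exp y) (exp s) (exp u) / pi\<^sup>2)"
    by (rule ext) (rule DERIV_imp_deriv[OF ronkin_has_derivative_x])
  have dy: "deriv (\<lambda>r. ronkin lin_poly (s, r, u)) y = mean_angle (exp s) (exp y) (exp u) / pi\<^sup>2" for s
    by (rule DERIV_imp_deriv[OF ronkin_has_derivative_y])
  have "((\<lambda>s. mean_angle (exp y) (exp s) (exp u) / pi\<^sup>2) has_real_derivative rhs_xx (x, y, u)) (at x)"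
    unfolding rhs_xx_eq_ell[OF gen] using gen
    by (intro DERIV_cdivide mean_angle_has_derivative_side) (simp add: generic_swap)
  then show "has_partial_xx (ronkin lin_poly) (rhs_xx (x, y, u)) (x, y, u)"
    using ronkin_has_derivative_x by (auto simp: has_partial_xx_def dx real_differentiable_def intro!: always_eventually)
  show "\<exists>d. has_partial_xy (ronkin lin_poly) d (x, y, u) \<and> extends_to rhs_xy nondegenerate (x, y, u) d"
  proof (intro exI conjI)
    have "((\<lambda>s. mean_angle (exp s) (exp y) (exp u) / pi\<^sup>2) has_real_derivative mixed_partial (exp x) (exp y) (exp u)) (at x)"
      unfolding mixed_partial_def by (intro DERIV_cdivide mean_angle_has_derivative_modulus gen)
    then show "has_partial_xy (ronkin lin_poly) (mixed_partial (exp x) (exp y) (exp u)) (x, y, u)"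
      using ronkin_has_derivative_y by (auto simp: has_partial_xy_def dy real_differentiable_def intro!: always_eventually)
    let ?U = "{(x, y, u). generic (exp x) (exp y) (exp u)}"
    have "?U = {z. generic (exp (fst z)) (exp (fst (snd z))) (exp (snd (snd z)))}" by auto
    also have "open \<dots>" by (intro open_generic continuous_intros)
    finally have U: "open ?U" .
    have "isCont (\<lambda>(x, y, u). mixed_partial (exp x) (exp y) (exp u)) (x, y, u)"
      using continuous_on_mixed_partial U gen by (auto simp: continuous_on_eq_continuous_at)
    then have lim: "((\<lambda>(x, y, u). mixed_partial (exp x) (exp y) (exp u)) \<longlongrightarrow> mixed_partial (exp x) (exp y) (exp u)) (at (x, y, u) within nondegenerate)"
      unfolding isCont_def by (auto intro: tendsto_within_subset)
    \<comment> \<open>Genericity is open, so near the point the stated formula agrees with the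
      continuous integral at all nondegenerate points; its limit is therefore the
      derivative.\<close>
    have "\<forall>\<^sub>F z in at (x, y, u) within nondegenerate. z \<in> ?U \<and> z \<in> nondegenerate"
      using U gen by (auto simp: eventually_at_topological)
    then have "\<forall>\<^sub>F z in at (x, y, u) within nondegenerate. rhs_xy z = (\<lambda>(x, y, u). mixed_partial (exp x) (exp y) (exp u)) z"
      by eventually_elim (auto simp: rhs_xy_eq_mixed_partial)
    then have "(rhs_xy \<longlongrightarrow> mixed_partial (exp x) (exp y) (exp u)) (at (x, y, u) within nondegenerate)"
      using lim by (subst tendsto_cong)
    then show "extends_to rhs_xy nondegenerate (x, y, u) (mixed_partial (exp x) (exp y) (exp u))"
      by (simp add: extends_to_def rhs_xy_eq_mixed_partial[OF gen])
  qed
qed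

end
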